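(* Let $T$ be a scalene triangle in the Euclidean plane. Then $T$ has exactly one quadrisection whose triangular portion lies on the middle leg of $T$ (the side of middle length), and $T$ has no quadrisection whose triangular portion lies on the longest leg of $T$ (the longest side).
   Context: A quadrisection of a (nondegenerate, closed) triangle $T$ is an unordered pair of perpendicular segments, each with its endpoints on the boundary of $T$, which intersect in a point $O$ in the interior of $T$ and divide $T$ into four regions of equal area. The triangular portion of a quadrisection lies on a side $s$ of $T$ if the two segments can be written $XP$ and $YQ$ with $X,Y$ on $s$, and the triangle $XOY$ is one of the four regions of equal area. *)

theory Defs
  imports "HOL-Analysis.Analysis"
begin

definition triangle :: "(real^2) set \<Rightarrow> bool" where
  "triangle T \<longleftrightarrow> (\<exists>A B C. \<not> collinear {A, B, C} \<and> T = convex hull {A, B, C})"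

text \<open>
  The sides (legs) of a triangle \<open>T\<close> are the sets \<open>s\<close> with \<open>s edge_of T\<close>; they are closed
  segments (lemma \<open>edge_of_triangle\<close>), and the diameter of a closed segment is its length
  (lemma \<open>diameter_closed_segment_eq\<close>).
\<close>

definition scalene_triangle :: "(real^2) set \<Rightarrow> bool" where
  "scalene_triangle T \<longleftrightarrow> triangle T \<and>
     (\<forall>s s'. s edge_of T \<and> s' edge_of T \<and> s \<noteq> s' \<longrightarrow> diameter s \<noteq> diameter s')"

definition middle_leg :: "(real^2) set \<Rightarrow> (real^2) set \<Rightarrow> bool" where
  "middle_leg T m \<longleftrightarrow> m edge_of T \<and>
     (\<exists>s. s edge_of T \<and> diameter s < diameter m) \<and>
     (\<exists>l. l edge_of T \<and> diameter m < diameter l)"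

definition longest_leg :: "(real^2) set \<Rightarrow> (real^2) set \<Rightarrow> bool" where
  "longest_leg T l \<longleftrightarrow> l edge_of T \<and>
     (\<forall>s. s edge_of T \<and> s \<noteq> l \<longrightarrow> diameter s < diameter l)"

text \<open>
  An unordered pair of segments is a set \<open>q\<close> of point sets. The regions into which it divides
  \<open>T\<close> are taken as closed sets, so that a triangular region is literally a closed triangle.
\<close>

definition regions :: "(real^2) set \<Rightarrow> (real^2) set set \<Rightarrow> (real^2) set set" where
  "regions T q = closure ` components (T - \<Union>q)"

definition quadrisection :: "(real^2) set \<Rightarrow> (real^2) set set \<Rightarrow> bool" where
  "quadrisection T q \<longleftrightarrow>
     (\<exists>X P Y Q Z. q = {closed_segment X P, closed_segment Y Q} \<and>
        {X, P, Y, Q} \<subseteq> frontier T \<and>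
        orthogonal (P - X) (Q - Y) \<and>
        closed_segment X P \<inter> closed_segment Y Q = {Z} \<and> Z \<in> interior T \<and>
        card (regions T q) = 4 \<and>
        (\<forall>R \<in> regions T q. \<forall>R' \<in> regions T q. measure lebesgue R = measure lebesgue R'))"

definition triangular_portion_on ::
    "(real^2) set \<Rightarrow> (real^2) set set \<Rightarrow> (real^2) set \<Rightarrow> bool" where
  "triangular_portion_on T q s \<longleftrightarrow>
     (\<exists>X P Y Q Z. q = {closed_segment X P, closed_segment Y Q} \<and>
        X \<in> s \<and> Y \<in> s \<and>
        closed_segment X P \<inter> closed_segment Y Q = {Z} \<and>
        convex hull {X, Z, Y} \<in> regions T q)"

lemma diameter_closed_segment_eq:
  fixes a b :: "'a::euclidean_space"
  shows "diameter (closed_segment a b) = dist a b"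
proof (rule antisym)
  have "norm (x - y) \<le> dist a b" if xy: "x \<in> closed_segment a b" "y \<in> closed_segment a b" for x y
  proof -
    obtain u v where u: "0 \<le> u" "u \<le> 1" "x = (1 - u) *\<^sub>R a + u *\<^sub>R b"
      and v: "0 \<le> v" "v \<le> 1" "y = (1 - v) *\<^sub>R a + v *\<^sub>R b"
      using xy by (auto simp: in_segment)
    have "x - y = (u - v) *\<^sub>R (b - a)" by (simp add: u v algebra_simps)
    then have "norm (x - y) = \<bar>u - v\<bar> * dist a b" by (simp add: dist_norm norm_minus_commute)
    also have "\<dots> \<le> 1 * dist a b" using u v by (intro mult_right_mono) auto
    finally show ?thesis by simp
  qed
  then show "diameter (closed_segment a b) \<le> dist a b"
    by (intro diameter_le) auto
  show "dist a b \<le> diameter (closed_segment a b)"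
    by (intro diameter_bounded_bound compact_imp_bounded) auto
qed

lemma edge_of_triangle:
  fixes A B C :: "real^2"
  assumes "\<not> collinear {A, B, C}"
  shows "s edge_of (convex hull {A, B, C}) \<longleftrightarrow>
           s \<in> {closed_segment A B, closed_segment B C, closed_segment C A}"
proof -
  have ne: "A \<noteq> B" "B \<noteq> C" "C \<noteq> A" using assms by (metis collinear_2 insert_absorb2 insert_commute)+
  have nd: "\<not> affine_dependent {A, B, C}"
    using assms collinear_3_eq_affine_dependent ne by metis
  have ad3: "aff_dim {A, B, C} = 2"
    using aff_dim_affine_independent [OF nd] ne by (simp add: card_insert_if)
  have ad2: "aff_dim {x, y} = 1" if "x \<noteq> y" for x y :: "real^2"
    using that aff_dim_affine_independent [OF affine_independent_2, of x y] by simp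
  have sub: "c \<in> {{}, {A}, {B}, {C}, {A, B}, {B, C}, {C, A}, {A, B, C}}" if "c \<subseteq> {A, B, C}" for c
    using that [folded Pow_iff] by (auto simp: Pow_insert)
  show ?thesis
  proof
    assume "s edge_of (convex hull {A, B, C})"
    then obtain c where c: "c \<subseteq> {A, B, C}" "s = convex hull c" "aff_dim c = 1"
      unfolding edge_of_def face_of_convex_hull_affine_independent [OF nd]
      by (auto simp: aff_dim_convex_hull)
    have "c \<notin> {{}, {A}, {B}, {C}, {A, B, C}}"
      using c(3) ad3 by auto
    with sub [OF c(1)] have "c = {A, B} \<or> c = {B, C} \<or> c = {C, A}" unfolding insert_iff empty_iff by argo
    with c(2) show "s \<in> {closed_segment A B, closed_segment B C, closed_segment C A}"
      unfolding segment_convex_hull by (elim disjE) simp_all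
  next
    have edge: "closed_segment x y edge_of (convex hull {A, B, C})"
      if "{x, y} \<subseteq> {A, B, C}" "x \<noteq> y" for x y
      unfolding edge_of_def face_of_convex_hull_affine_independent [OF nd] segment_convex_hull
      using that ad2 [OF that(2)] by (metis aff_dim_convex_hull)
    assume "s \<in> {closed_segment A B, closed_segment B C, closed_segment C A}"
    then show "s edge_of (convex hull {A, B, C})"
      using edge [of A B] edge [of B C] edge [of C A] ne by auto
  qed
qed

end

theory Submission
  imports Defs
begin

text \<open>
  Let \<open>a\<close>, \<open>b\<close>, \<open>c\<close> be the lengths of the sides \<open>BC\<close>, \<open>CA\<close>, \<open>AB\<close> of a triangle, and look for the
  quadrisections \<open>XP\<close>, \<open>YQ\<close> whose triangular portion \<open>XOY\<close> lies on \<open>BC\<close>.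

  Each of the two segments has two of the four regions on each side, so it halves the area. If \<open>XP\<close>
  runs from \<open>BC\<close> to \<open>CA\<close>, this means \<open>X = C + u (B - C)\<close> and \<open>P = C + (A - C) / (2 u)\<close> with
  \<open>1/2 \<le> u \<le> 1\<close> (\<open>bisecting_chord\<close>). The two segments cannot both end on \<open>CA\<close>, nor both on \<open>AB\<close>
  (\<open>no_quartering_towards_one_side\<close>). So the pair is given by \<open>u\<close> and a similar parameter \<open>v\<close> at
  the corner \<open>B\<close>, and conversely such a pair is a quadrisection if the area of \<open>XOY\<close> is a quarter and
  the segments are perpendicular (\<open>quadrisection_imp_admissible\<close>, \<open>admissible_imp_quadrisection\<close>).

  The condition on the area is \<open>4 (u + v - 1)\<^sup>2 = 2 u\<^sup>2 + 2 v\<^sup>2 - 1\<close>. It is invariant under affine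
  maps, so it is the same for all triangles; it describes an arc of a hyperbola from
  \<open>(1, 1/\<surd>2)\<close> to \<open>(1/\<surd>2, 1)\<close>. Perpendicularity is the vanishing of a function \<open>perp_defect\<close> of
  \<open>u\<close> and \<open>v\<close>, whose values at these two ends of the arc are \<open>2 (a\<^sup>2 - c\<^sup>2)\<close> and
  \<open>2 (a\<^sup>2 - b\<^sup>2)\<close>. They are both positive if \<open>BC\<close> is the longest side, and they have opposite signs
  if \<open>BC\<close> is the middle one.

  What remains is that the function is strictly quasiconcave along the arc: between two points it is
  larger than the smaller of its values there. Then it has no zero on the arc for the longest side,
  and exactly one for the middle side. The reason for quasiconcavity is that, with \<open>U = 2 u\<^sup>2\<close> and
  \<open>V = 2 v\<^sup>2\<close>, the function is a positive multiple of \<open>(U - 1/2) (V - 1/2)\<close> plus an affine function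
  of \<open>U - V\<close>, and along the arc \<open>(U - 1/2) (V - 1/2)\<close> is a strictly concave function of \<open>U - V\<close>
  (\<open>slope_ratio_strict_mono\<close>, \<open>strictly_quasiconcave\<close>).
\<close>

section \<open>The arc and the perpendicularity function\<close>

text \<open>
  The equation says that the triangle \<open>XOY\<close> has a quarter of the area; it does not involve the
  shape of the given triangle. It cuts out an arc of a hyperbola from \<open>(1, 1/\<surd>2)\<close> to \<open>(1/\<surd>2, 1)\<close>.
\<close>

definition admissible :: "real \<Rightarrow> real \<Rightarrow> bool" where
  "admissible u v \<longleftrightarrow> 1/2 \<le> u \<and> u \<le> 1 \<and> 1/2 \<le> v \<and> v \<le> 1 \<and> 1 < u + v \<and>
     4 * (u + v - 1)\<^sup>2 = 2 * u\<^sup>2 + 2 * v\<^sup>2 - 1"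

text \<open>
  Up to a nonzero factor this is the inner product of the directions of the two segments (see
  \<open>perp_defect_eq_inner\<close> below), for a triangle with sides \<open>a = BC\<close>, \<open>b = CA\<close>, \<open>c = AB\<close>.
  It is affine in each of \<open>2 * u\<^sup>2\<close> and \<open>2 * v\<^sup>2\<close>.
\<close>

definition perp_defect :: "real \<Rightarrow> real \<Rightarrow> real \<Rightarrow> real \<Rightarrow> real \<Rightarrow> real" where
  "perp_defect a b c u v = 2 * a\<^sup>2 * (2 * u\<^sup>2) * (2 * v\<^sup>2) - (a\<^sup>2 + b\<^sup>2 - c\<^sup>2) * (2 * v\<^sup>2)
     - (a\<^sup>2 + c\<^sup>2 - b\<^sup>2) * (2 * u\<^sup>2) - (b\<^sup>2 + c\<^sup>2 - a\<^sup>2)"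

text \<open>
  The lines through the point \<open>(u, v) = (1/2, 1/2)\<close> of the hyperbola parametrise it rationally:
  with \<open>t = (u - v) / (u + v - 1)\<close> one gets \<open>u = curve t\<close> and \<open>v = curve (- t)\<close>, and
  \<open>u, v \<le> 1\<close> becomes \<open>\<bar>t\<bar> \<le> \<surd>2 - 1\<close>.
\<close>

definition curve :: "real \<Rightarrow> real" where
  "curve t = 1/2 + (1 + t) / (3 - t\<^sup>2)"

lemma sq_le_quarter: "\<bar>t\<bar> \<le> 1/2 \<Longrightarrow> t\<^sup>2 \<le> 1/(4::real)"
  using abs_le_square_iff[of t "1/2"] by (simp add: power2_eq_square)

lemma sqrt2_minus_1_le_half: "sqrt 2 - 1 \<le> 1/2"
proof -
  have "sqrt 2 \<le> 3/2" by (rule real_le_lsqrt) (auto simp: power2_eq_square)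
  then show ?thesis by simp
qed

lemma admissible_imp_curve:
  assumes "admissible u v"
  obtains t where "\<bar>t\<bar> \<le> sqrt 2 - 1" "u = curve t" "v = curve (- t)"
proof -
  define w where "w = u + v - 1"
  define t where "t = (u - v) / w"
  have w: "w > 0" and u1: "u \<le> 1" and v1: "v \<le> 1" using assms by (auto simp: admissible_def w_def)
  have d: "u - v = t * w" using w by (simp add: t_def)
  have u: "u = (1 + w + t * w) / 2" and v: "v = (1 + w - t * w) / 2"
    using d by (simp_all add: w_def)
  have "4 * w\<^sup>2 = 2 * u\<^sup>2 + 2 * v\<^sup>2 - 1" using assms by (simp add: admissible_def w_def)
  then have "w * (w * (3 - t\<^sup>2) - 2) = 0"
    unfolding u v by (simp add: power2_eq_square field_simps)
  then have wt: "w * (3 - t\<^sup>2) = 2" using w by simp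
  then have "3 - t\<^sup>2 > 0" using w by (metis zero_less_mult_pos zero_less_numeral)
  with wt have weq: "w = 2 / (3 - t\<^sup>2)" by (simp add: field_simps)
  have "u = curve t" "v = curve (- t)"
    unfolding u v weq curve_def using \<open>3 - t\<^sup>2 > 0\<close>
    by (simp_all add: divide_simps) (simp_all add: algebra_simps)
  moreover have "(1 + t)\<^sup>2 \<le> 2"
    using u1 \<open>3 - t\<^sup>2 > 0\<close> unfolding \<open>u = curve t\<close> curve_def by (simp add: field_simps power2_eq_square)
  moreover have "(1 - t)\<^sup>2 \<le> 2"
    using v1 \<open>3 - t\<^sup>2 > 0\<close> unfolding \<open>v = curve (- t)\<close> curve_def by (simp add: field_simps power2_eq_square)
  ultimately show ?thesis using that[of t] real_le_rsqrt[of "1 + t" 2] real_le_rsqrt[of "1 - t" 2]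
    by linarith
qed

lemma curve_admissible:
  assumes "\<bar>t\<bar> \<le> sqrt 2 - 1"
  shows "admissible (curve t) (curve (- t))"
proof -
  have t: "\<bar>t\<bar> \<le> 1/2" using assms sqrt2_minus_1_le_half by linarith
  have D: "3 - t\<^sup>2 > 0" using sq_le_quarter[OF t] by linarith
  have "(1 + t)\<^sup>2 \<le> (sqrt 2)\<^sup>2" "(1 - t)\<^sup>2 \<le> (sqrt 2)\<^sup>2"
    using assms t by (intro power_mono; linarith)+
  then have "curve t \<le> 1" "curve (- t) \<le> 1"
    using D by (simp_all add: curve_def field_simps power2_eq_square)
  moreover have "curve t \<ge> 1/2" "curve (- t) \<ge> 1/2" using D t by (simp_all add: curve_def)
  moreover define w where "w = 1 / (3 - t\<^sup>2)"
  have c: "curve t = 1/2 + (1 + t) * w" "curve (- t) = 1/2 + (1 - t) * w"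
    by (simp_all add: curve_def w_def)
  have "w * (3 - t\<^sup>2) = 1" and "w > 0" using D by (simp_all add: w_def)
  then have "4 * (2 * w)\<^sup>2 = 2 * (curve t)\<^sup>2 + 2 * (curve (- t))\<^sup>2 - 1"
    unfolding c by algebra
  moreover have "curve t + curve (- t) - 1 = 2 * w" unfolding c by (simp add: algebra_simps)
  ultimately show ?thesis unfolding admissible_def using \<open>w > 0\<close> by auto
qed

lemma curve_end:
  "curve (sqrt 2 - 1) = 1" "(curve (- (sqrt 2 - 1)))\<^sup>2 = 1/2"
proof -
  have e: "3 - (sqrt 2 - 1)\<^sup>2 = 2 * sqrt 2" by (simp add: power2_eq_square algebra_simps)
  show "curve (sqrt 2 - 1) = 1" unfolding curve_def e by simp
  have "curve (- (sqrt 2 - 1)) = 1 / sqrt 2"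
    unfolding curve_def power2_minus e by (simp add: field_simps)
  then show "(curve (- (sqrt 2 - 1)))\<^sup>2 = 1/2" by (simp add: power_divide)
qed

text \<open>
  With \<open>U = 2 * u\<^sup>2\<close> and \<open>V = 2 * v\<^sup>2\<close> at the point with parameter \<open>t\<close>, the functions \<open>gap\<close> and
  \<open>shifted_product\<close> are \<open>U - V\<close> and \<open>4 * (U - 1/2) * (V - 1/2)\<close>. The functions \<open>gap'\<close> and
  \<open>slope_ratio\<close> are the derivative of \<open>gap\<close> and the negated derivative of \<open>shifted_product\<close> with
  respect to \<open>gap\<close>.
\<close>

definition gap :: "real \<Rightarrow> real" where
  "gap t = 4 * t * (5 - t\<^sup>2) / (3 - t\<^sup>2)\<^sup>2"

definition shifted_product :: "real \<Rightarrow> real" where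
  "shifted_product t = 16 * (16 - 25 * t\<^sup>2 + 10 * t^4 - t^6) / (3 - t\<^sup>2)^4"

definition gap' :: "real \<Rightarrow> real" where
  "gap' t = 4 * (15 + 6 * t\<^sup>2 - t^4) / (3 - t\<^sup>2)^3"

definition slope_ratio :: "real \<Rightarrow> real" where
  "slope_ratio t = 8 * (t / (3 - t\<^sup>2)\<^sup>2) * ((11 + 15 * t\<^sup>2 - 11 * t^4 + t^6) / (15 + 6 * t\<^sup>2 - t^4))"

lemma perp_defect_curve:
  assumes "\<bar>t\<bar> \<le> 1/2"
  shows "perp_defect a b c (curve t) (curve (- t)) =
    a\<^sup>2 / 2 * shifted_product t + (b\<^sup>2 - c\<^sup>2) * gap t - (b\<^sup>2 + c\<^sup>2 - a\<^sup>2 / 2)"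
proof -
  define U where "U = 2 * (curve t)\<^sup>2"
  define V where "V = 2 * (curve (- t))\<^sup>2"
  have D: "3 - t\<^sup>2 \<noteq> 0" using sq_le_quarter[OF assms] by linarith
  have U: "U = 1/2 + (8 + 10 * t - 2 * t^3) / (3 - t\<^sup>2)\<^sup>2"
    and V: "V = 1/2 + (8 - 10 * t + 2 * t^3) / (3 - t\<^sup>2)\<^sup>2"
    unfolding U_def V_def curve_def using D
    by (simp add: divide_simps; simp add: algebra_simps eval_nat_numeral)+
  have d: "gap t = U - V" unfolding U V gap_def
    using D by (simp add: divide_simps) (simp add: algebra_simps eval_nat_numeral)
  have "shifted_product t = 4 * ((8 + 10 * t - 2 * t^3) / (3 - t\<^sup>2)\<^sup>2) * ((8 - 10 * t + 2 * t^3) / (3 - t\<^sup>2)\<^sup>2)"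
    unfolding shifted_product_def using D
    by (simp add: divide_simps) (simp add: algebra_simps eval_nat_numeral)
  also have "\<dots> = 4 * (U - 1/2) * (V - 1/2)" unfolding U V by simp
  finally have p: "shifted_product t = 4 * (U - 1/2) * (V - 1/2)" .
  show ?thesis unfolding perp_defect_def d p U_def[symmetric] V_def[symmetric]
    by (simp add: algebra_simps)
qed

lemma gap'_pos:
  assumes "\<bar>t\<bar> \<le> 1/2"
  shows "gap' t > 0" "15 + 6 * t\<^sup>2 - t^4 > 0"
proof -
  have "t^4 = t\<^sup>2 * t\<^sup>2" by (simp add: eval_nat_numeral)
  also have "\<dots> \<le> 1 * t\<^sup>2" using sq_le_quarter[OF assms] by (intro mult_right_mono) auto
  finally show "15 + 6 * t\<^sup>2 - t^4 > 0" using zero_le_power2[of t] by linarith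
  then show "gap' t > 0" using sq_le_quarter[OF assms] by (simp add: gap'_def)
qed

lemma gap_deriv:
  assumes "\<bar>t\<bar> \<le> 1/2"
  shows "(gap has_real_derivative gap' t) (at t)"
proof -
  have n: "3 - t\<^sup>2 \<noteq> 0" using sq_le_quarter[OF assms] by auto
  show ?thesis unfolding gap_def gap'_def
    apply (rule derivative_eq_intros refl | use n in simp; fail)+
    using n apply (simp add: divide_simps)
    apply (simp add: algebra_simps eval_nat_numeral)
    done
qed

lemma shifted_product_deriv:
  assumes "\<bar>t\<bar> \<le> 1/2"
  shows "(shifted_product has_real_derivative - (slope_ratio t * gap' t)) (at t)"
proof -
  have n: "3 - t\<^sup>2 \<noteq> 0" using sq_le_quarter[OF assms] by auto
  note m = gap'_pos(2)[OF assms]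
  have "- (slope_ratio t * gap' t) = - 32 * t * (11 + 15 * t\<^sup>2 - 11 * t^4 + t^6) / (3 - t\<^sup>2)^5"
    using n m unfolding slope_ratio_def gap'_def
    by (simp add: divide_simps)
  moreover have "(shifted_product has_real_derivative - 32 * t * (11 + 15 * t\<^sup>2 - 11 * t^4 + t^6) / (3 - t\<^sup>2)^5) (at t)"
    unfolding shifted_product_def
    apply (rule derivative_eq_intros refl | use n in simp; fail)+
    using n apply (simp add: divide_simps)
    apply (simp add: algebra_simps eval_nat_numeral)
    done
  ultimately show ?thesis by simp
qed

text \<open>
  This is concavity of \<open>shifted_product\<close> as a function of \<open>gap\<close>. For \<open>0 \<le> t \<le> 1/2\<close> the first factor
  of \<open>slope_ratio\<close> is nonnegative and strictly increasing, and the second one is positive and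
  nondecreasing. Since \<open>slope_ratio\<close> is odd, it is strictly increasing on the negative side as well.
\<close>

lemma slope_ratio_strict_mono_nonneg:
  assumes "0 \<le> s" "s < t" "t \<le> 1/2"
  shows "slope_ratio s < slope_ratio t"
proof -
  define x y where "x = s\<^sup>2" and "y = t\<^sup>2"
  have xy: "0 \<le> x" "x \<le> y" "y \<le> 1/4"
    using assms power_mono[of s t 2] sq_le_quarter[of t] by (auto simp: x_def y_def)
  have e4: "s^4 = x\<^sup>2" "t^4 = y\<^sup>2" "s^6 = x^3" "t^6 = y^3"
    by (simp_all add: x_def y_def eval_nat_numeral)
  have ms: "15 + 6 * x - x\<^sup>2 > 0" "15 + 6 * y - y\<^sup>2 > 0"
    using gap'_pos(2)[of s] gap'_pos(2)[of t] assms by (auto simp: e4 x_def[symmetric] y_def[symmetric])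
  have "s / (3 - x)\<^sup>2 \<le> s / (3 - y)\<^sup>2"
    using xy assms by (intro divide_left_mono power_mono mult_pos_pos) auto
  also have "\<dots> < t / (3 - y)\<^sup>2"
    using xy assms by (intro divide_strict_right_mono) auto
  finally have 1: "s / (3 - x)\<^sup>2 < t / (3 - y)\<^sup>2" .
  have N: "11 + 15 * x - 11 * x\<^sup>2 + x^3 > 0"
  proof -
    have "x * x \<le> 1 * x" using xy by (intro mult_right_mono) auto
    moreover have "0 \<le> x^3" using xy by simp
    ultimately show ?thesis using xy unfolding power2_eq_square by linarith
  qed
  have 2: "(11 + 15 * x - 11 * x\<^sup>2 + x^3) / (15 + 6 * x - x\<^sup>2)
        \<le> (11 + 15 * y - 11 * y\<^sup>2 + y^3) / (15 + 6 * y - y\<^sup>2)"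
  proof -
    have b: "x * x \<le> 1/16" "y * y \<le> 1/16" "x * y \<le> 1/16" "0 \<le> x * y" "0 \<le> x * x" "0 \<le> y * y"
      using xy mult_mono[of x "1/4" x "1/4"] mult_mono[of y "1/4" y "1/4"] mult_mono[of x "1/4" y "1/4"] by auto
    have xxyy: "0 \<le> (x * x) * (y * y)" "(x * x) * (y * y) \<le> (1/16) * (1/16)"
      using b mult_mono[of "x * x" "1/16" "y * y" "1/16"] by (auto simp del: mult_le_cancel_left)
    have xy2: "0 \<le> (x * y) * (x + y)" "(x * y) * (x + y) \<le> (1/16) * (1/2)"
      using b xy mult_mono[of "x * y" "1/16" "x + y" "1/2"] by auto
    \<comment> \<open>The cofactor of \<open>y - x\<close> in the cross-multiplied difference of the two fractions.\<close>
    have "0 \<le> 159 - 154 * (x + y) - 51 * (x * y) + 15 * (x * x + x * y + y * y)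
            + 6 * ((x * y) * (x + y)) - (x * x) * (y * y)"
    proof -
      have "0 \<le> 159 - 154 * s - 51 * p + 15 * q + 6 * k - l"
        if "s \<le> 1/2" "p \<le> 1/16" "0 \<le> q" "0 \<le> k" "l \<le> (1/16) * (1/16)" for s p q k l :: real
        using that by linarith
      from this[of "x + y" "x * y" "x * x + x * y + y * y" "(x * y) * (x + y)" "(x * x) * (y * y)"]
      show ?thesis using xy b xxyy xy2 by linarith
    qed
    then have "0 \<le> (y - x) * (159 - 154 * (x + y) - 51 * (x * y) + 15 * (x * x + x * y + y * y)
            + 6 * ((x * y) * (x + y)) - (x * x) * (y * y))"
      using xy by (intro mult_nonneg_nonneg) auto
    also have "\<dots> = (11 + 15 * y - 11 * y\<^sup>2 + y^3) * (15 + 6 * x - x\<^sup>2)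
            - (11 + 15 * x - 11 * x\<^sup>2 + x^3) * (15 + 6 * y - y\<^sup>2)"
      by (simp add: algebra_simps eval_nat_numeral)
    finally have le: "(11 + 15 * x - 11 * x\<^sup>2 + x^3) * (15 + 6 * y - y\<^sup>2)
          \<le> (11 + 15 * y - 11 * y\<^sup>2 + y^3) * (15 + 6 * x - x\<^sup>2)" by linarith
    have "p / q \<le> p' / q'" if "p * q' \<le> p' * q" "q > 0" "q' > 0" for p q p' q' :: real
      using that by (simp add: field_simps)
    from this[OF le ms] show ?thesis .
  qed
  have "s / (3 - x)\<^sup>2 * ((11 + 15 * x - 11 * x\<^sup>2 + x^3) / (15 + 6 * x - x\<^sup>2))
      < t / (3 - y)\<^sup>2 * ((11 + 15 * y - 11 * y\<^sup>2 + y^3) / (15 + 6 * y - y\<^sup>2))"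
    using 1 2 assms N ms by (intro mult_less_le_imp_less) auto
  then show ?thesis unfolding slope_ratio_def e4 x_def[symmetric] y_def[symmetric] mult.assoc by simp
qed

lemma slope_ratio_minus: "slope_ratio (- t) = - slope_ratio t"
  by (simp add: slope_ratio_def)

lemma slope_ratio_strict_mono:
  assumes "- (1/2) \<le> s" "s < t" "t \<le> 1/2"
  shows "slope_ratio s < slope_ratio t"
proof -
  have 0: "slope_ratio 0 = 0" by (simp add: slope_ratio_def)
  have neg: "slope_ratio s < 0" if "s < 0"
    using slope_ratio_strict_mono_nonneg[of 0 "- s"] that assms 0 by (simp add: slope_ratio_minus)
  have pos: "0 < slope_ratio t" if "t > 0"
    using slope_ratio_strict_mono_nonneg[of 0 t] that assms 0 by simp
  consider "0 \<le> s" | "t \<le> 0" | "s < 0" "0 < t" by linarith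
  then show ?thesis
  proof cases
    case 1 then show ?thesis using slope_ratio_strict_mono_nonneg assms by simp
  next
    case 2 then show ?thesis using slope_ratio_strict_mono_nonneg[of "- t" "- s"] assms by (simp add: slope_ratio_minus)
  qed (use neg pos in linarith)
qed

text \<open>
  The derivative is \<open>gap'\<close>, which is positive, times \<open>N - M * slope_ratio\<close>, which is strictly
  decreasing. Hence it cannot be nonpositive somewhere before \<open>s\<close> and nonnegative somewhere after \<open>s\<close>,
  as the mean value theorem would give if \<open>f s\<close> did not exceed one of the outer values.
\<close>

lemma strictly_quasiconcave:
  fixes M N K :: real
  defines "f \<equiv> \<lambda>t. M * shifted_product t + N * gap t - K"
  assumes "M > 0" "- (1/2) \<le> r" "r < s" "s < t" "t \<le> 1/2"
  shows "min (f r) (f t) < f s"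
proof (rule ccontr)
  assume "\<not> ?thesis"
  then have le: "f s \<le> f r" "f s \<le> f t" by auto
  have der: "(f has_real_derivative gap' x * (N - M * slope_ratio x)) (at x)" if "\<bar>x\<bar> \<le> 1/2" for x
    unfolding f_def
    by (rule derivative_eq_intros shifted_product_deriv gap_deriv that refl)+ (simp add: algebra_simps)
  obtain x where x: "r < x" "x < s" "f s - f r = (s - r) * (gap' x * (N - M * slope_ratio x))"
    using MVT2[OF \<open>r < s\<close>, of f "\<lambda>x. gap' x * (N - M * slope_ratio x)"] der assms by auto
  obtain y where y: "s < y" "y < t" "f t - f s = (t - s) * (gap' y * (N - M * slope_ratio y))"
    using MVT2[OF \<open>s < t\<close>, of f "\<lambda>x. gap' x * (N - M * slope_ratio x)"] der assms by auto
  have "\<bar>x\<bar> \<le> 1/2" "\<bar>y\<bar> \<le> 1/2" using x y assms by auto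
  then have pos: "gap' x > 0" "gap' y > 0" using gap'_pos by auto
  have "(s - r) * (gap' x * (N - M * slope_ratio x)) \<le> 0" using x(3) le by linarith
  then have "N - M * slope_ratio x \<le> 0" using pos(1) \<open>r < s\<close>
    by (simp add: mult_le_0_iff)
  moreover have "0 \<le> (t - s) * (gap' y * (N - M * slope_ratio y))" using y(3) le by linarith
  then have "N - M * slope_ratio y \<ge> 0" using pos(2) \<open>s < t\<close>
    by (simp add: zero_le_mult_iff)
  ultimately have "M * slope_ratio y \<le> M * slope_ratio x" by linarith
  then have "slope_ratio y \<le> slope_ratio x" using \<open>M > 0\<close> by simp
  then show False using slope_ratio_strict_mono[of x y] x y assms by linarith
qed

lemma perp_defect_strictly_quasiconcave:
  fixes a b c :: real
  defines "f \<equiv> \<lambda>t. perp_defect a b c (curve t) (curve (- t))"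
  assumes "a > 0" "- (1/2) \<le> r" "r < s" "s < t" "t \<le> 1/2"
  shows "min (f r) (f t) < f s"
proof -
  have "f x = a\<^sup>2 / 2 * shifted_product x + (b\<^sup>2 - c\<^sup>2) * gap x - (b\<^sup>2 + c\<^sup>2 - a\<^sup>2 / 2)"
    if "- (1/2) \<le> x" "x \<le> 1/2" for x
    unfolding f_def using that by (intro perp_defect_curve) auto
  then show ?thesis
    using strictly_quasiconcave[of "a\<^sup>2 / 2" r s t "b\<^sup>2 - c\<^sup>2" "b\<^sup>2 + c\<^sup>2 - a\<^sup>2 / 2"] assms(2-)
    by auto
qed

text \<open>
  This is where the order of the side lengths enters: the signs at the two ends of the arc compare
  \<open>BC\<close> with \<open>AB\<close> and with \<open>CA\<close>.
\<close>

lemma perp_defect_ends: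
  assumes "r = sqrt 2 - 1"
  shows "perp_defect a b c (curve r) (curve (- r)) = 2 * (a\<^sup>2 - c\<^sup>2)"
    and "perp_defect a b c (curve (- r)) (curve r) = 2 * (a\<^sup>2 - b\<^sup>2)"
proof -
  note e = curve_end[folded assms]
  show "perp_defect a b c (curve r) (curve (- r)) = 2 * (a\<^sup>2 - c\<^sup>2)"
    unfolding perp_defect_def e by (simp add: algebra_simps)
  show "perp_defect a b c (curve (- r)) (curve r) = 2 * (a\<^sup>2 - b\<^sup>2)"
    unfolding perp_defect_def e by (simp add: algebra_simps)
qed

text \<open>
  Both end values are positive, so by quasiconcavity all values are.
\<close>

lemma no_admissible_perp:
  assumes "0 < b" "b < a" "0 < c" "c < a" "admissible u v"
  shows "perp_defect a b c u v \<noteq> 0"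
proof -
  define r where "r = sqrt 2 - (1::real)"
  obtain t where t: "\<bar>t\<bar> \<le> r" "u = curve t" "v = curve (- t)"
    using admissible_imp_curve assms(5) unfolding r_def by metis
  have r: "0 < r" "r \<le> 1/2" using sqrt2_minus_1_le_half by (auto simp: r_def)
  have e: "perp_defect a b c (curve r) (curve (- r)) > 0" "perp_defect a b c (curve (- r)) (curve r) > 0"
    unfolding perp_defect_ends[OF r_def] using assms by (auto intro!: power_strict_mono)
  consider "t = r" | "t = - r" | "- r < t" "t < r" using t by linarith
  then have "0 < perp_defect a b c (curve t) (curve (- t))"
    by cases (use e perp_defect_strictly_quasiconcave[of a "-r" t r b c] r assms in auto)
  then show ?thesis by (simp add: t)
qed

text \<open>
  The end values have opposite signs, which gives a zero. A second zero would lie strictly between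
  the first one and the end with positive value, where quasiconcavity makes the function positive.
\<close>

lemma unique_admissible_perp:
  assumes "0 < c" "c < a" "a < b"
  obtains u v where "admissible u v" "perp_defect a b c u v = 0"
    "\<And>u' v'. admissible u' v' \<Longrightarrow> perp_defect a b c u' v' = 0 \<Longrightarrow> u' = u \<and> v' = v"
proof -
  define r where "r = sqrt 2 - (1::real)"
  define f where "f t = perp_defect a b c (curve t) (curve (- t))" for t
  have r: "0 < r" "r \<le> 1/2" using sqrt2_minus_1_le_half by (auto simp: r_def)
  have e: "f r > 0" "f (- r) < 0"
    unfolding f_def minus_minus perp_defect_ends[OF r_def] using assms
    by (auto simp: mult_less_0_iff intro!: power_strict_mono)
  have t2: "x\<^sup>2 \<noteq> 3" if "x \<in> {-r..r}" for x
  proof -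
    have "\<bar>x\<bar> \<le> 1/2" using that r by auto
    from sq_le_quarter[OF this] show ?thesis by auto
  qed
  have "continuous_on {-r..r} curve" "continuous_on {-r..r} (\<lambda>t. curve (- t))"
    unfolding curve_def by (intro continuous_intros; use t2 in force)+
  then have cont: "continuous_on {-r..r} f"
    unfolding f_def perp_defect_def by (auto intro!: continuous_intros)
  then obtain t where t: "-r \<le> t" "t \<le> r" "f t = 0"
    using IVT'[of f "-r" 0 r] e r by auto
  have uniq: "s = s'" if "f s = 0" "f s' = 0" "\<bar>s\<bar> \<le> r" "\<bar>s'\<bar> \<le> r" for s s'
  proof -
    have no: False if "f x = 0" "f y = 0" "x < y" "\<bar>x\<bar> \<le> r" "\<bar>y\<bar> \<le> r" for x y
    proof -
      have "y < r" using that e by (cases "y = r") auto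
      then have "min (f x) (f r) < f y"
        using perp_defect_strictly_quasiconcave[of a x y r b c] that assms r unfolding f_def by auto
      with that e show False by auto
    qed
    show ?thesis using no[of s s'] no[of s' s] that by (cases s s' rule: linorder_cases) auto
  qed
  show ?thesis
  proof (rule that[of "curve t" "curve (- t)"])
    show "admissible (curve t) (curve (- t))" using t r_def curve_admissible by auto
    show "perp_defect a b c (curve t) (curve (- t)) = 0" using t by (simp add: f_def)
    fix u' v' assume *: "admissible u' v'" "perp_defect a b c u' v' = 0"
    then obtain s where s: "\<bar>s\<bar> \<le> r" "u' = curve s" "v' = curve (- s)"
      using admissible_imp_curve unfolding r_def by metis
    then have "s = t" using uniq[of s t] * t by (auto simp: f_def)
    then show "u' = curve t \<and> v' = curve (- t)" using s by simp
  qed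
qed

section \<open>Areas and chords in the plane\<close>

definition cross2 :: "real^2 \<Rightarrow> real^2 \<Rightarrow> real" where
  "cross2 x y = x$1 * y$2 - x$2 * y$1"

lemma measure_triangle:
  "measure lebesgue (convex hull {A, B, C :: real^2}) = \<bar>cross2 (B - A) (C - A)\<bar> / 2"
proof -
  have "convex hull {A, B, C} \<in> sets borel"
    by (simp add: borel_compact compact_convex_hull)
  then have "measure lebesgue (convex hull {A, B, C}) = measure lborel (convex hull {A, B, C})"
    by simp
  then show ?thesis by (simp add: content_triangle cross2_def algebra_simps abs_minus_commute)
qed

lemma cross2_nonzero:
  assumes "\<not> collinear {A, B, C}"
  shows "cross2 (B - A) (C - A) \<noteq> 0"
proof
  assume 0: "cross2 (B - A) (C - A) = 0"
  have "((B - A) \<bullet> (C - A))\<^sup>2 + (cross2 (B - A) (C - A))\<^sup>2 = (norm (B - A))\<^sup>2 * (norm (C - A))\<^sup>2"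
    unfolding power2_norm_eq_inner by (simp add: inner_vec_def sum_2 cross2_def algebra_simps power2_eq_square)
  then have "\<bar>(B - A) \<bullet> (C - A)\<bar>\<^sup>2 = (norm (B - A) * norm (C - A))\<^sup>2"
    unfolding 0 by (simp add: power_mult_distrib)
  then have "\<bar>(B - A) \<bullet> (C - A)\<bar> = norm (B - A) * norm (C - A)"
    by (rule power2_eq_imp_eq) simp_all
  then have "collinear {0, B - A, C - A}" by (simp add: norm_cauchy_schwarz_equal)
  then have "collinear {B, A, C}"
    by (subst collinear_3) simp_all
  then have "collinear {A, B, C}" by (simp add: insert_commute)
  with assms show False by simp
qed

lemma orthogonal_imp_multiple:
  fixes d n y :: "real^2"
  assumes "d \<noteq> 0" "n \<noteq> 0" "d \<bullet> n = 0" "y \<bullet> n = 0"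
  obtains k where "y = k *\<^sub>R d"
proof -
  have dd: "d \<bullet> d \<noteq> 0" using assms by simp
  have n: "n$1 \<noteq> 0 \<or> n$2 \<noteq> 0" using assms(2) by (metis exhaust_2 vec_eq_iff zero_index)
  have "d$1 * n$1 + d$2 * n$2 = 0" "y$1 * n$1 + y$2 * n$2 = 0"
    using assms(3,4) by (simp_all add: inner_vec_def sum_2)
  then have "n$1 * cross2 y d = 0" "n$2 * cross2 y d = 0" unfolding cross2_def by algebra+
  then have c: "cross2 y d = 0" using n by auto
  have "(d \<bullet> d) *\<^sub>R y = (y \<bullet> d) *\<^sub>R d"
    using c by (simp add: vec_eq_iff forall_2 inner_vec_def sum_2 cross2_def) algebra
  then have "y = ((y \<bullet> d) / (d \<bullet> d)) *\<^sub>R d"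
    using dd by (metis (no_types) divideR_right divide_inverse_commute scaleR_scaleR)
  then show ?thesis using that by blast
qed

text \<open>
  A point strictly between an interior point and a point of a convex set is interior.
\<close>

lemma frontier_point_ends_ray:
  fixes T :: "'a::euclidean_space set"
  assumes "convex T" "Z \<in> interior T" "Z + p *\<^sub>R d \<in> frontier T" "0 < p" "Z + k *\<^sub>R d \<in> T"
  shows "k \<le> p"
proof (rule ccontr)
  assume "\<not> k \<le> p"
  then have k: "p < k" by simp
  have "d \<noteq> 0" using assms(2,3) by (auto simp: frontier_def)
  have "Z + p *\<^sub>R d = (1 - p / k) *\<^sub>R Z + (p / k) *\<^sub>R (Z + k *\<^sub>R d)"
    using k assms(4) by (simp add: algebra_simps)
  then have "Z + p *\<^sub>R d \<in> open_segment Z (Z + k *\<^sub>R d)"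
    using k assms(4) \<open>d \<noteq> 0\<close> unfolding in_segment by (auto intro!: exI[of _ "p / k"])
  then have "Z + p *\<^sub>R d \<in> interior T"
    using in_interior_closure_convex_segment[OF assms(1,2)] assms(5) closure_subset by blast
  with assms(3) show False by (simp add: frontier_def)
qed

text \<open>
  A chord through an interior point cannot be prolonged inside the convex set, so it is all that the
  set has in common with the line carrying it. This turns removal of the chords from a triangle into
  removal of two lines.
\<close>

lemma chord_eq_line_section:
  fixes T :: "(real^2) set"
  assumes T: "convex T" "closed T" and fr: "X \<in> frontier T" "P \<in> frontier T"
    and Z: "Z \<in> closed_segment X P" "Z \<in> interior T"
    and n: "n \<noteq> 0" "(P - X) \<bullet> n = 0"
  shows "closed_segment X P = T \<inter> {x. (x - Z) \<bullet> n = 0}"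
proof -
  have XT: "X \<in> T" "P \<in> T" using fr T frontier_subset_closed by blast+
  obtain l where l: "0 \<le> l" "l \<le> 1" "Z = (1 - l) *\<^sub>R X + l *\<^sub>R P" using Z(1) by (auto simp: in_segment)
  define d where "d = P - X"
  have Zl: "Z = X + l *\<^sub>R d" by (simp add: l d_def algebra_simps)
  have "Z \<noteq> X" "Z \<noteq> P" using fr Z by (auto simp: frontier_def)
  then have l01: "0 < l" "l < 1" and d0: "d \<noteq> 0" using l Zl by (auto simp: less_le d_def)
  have XZ: "X = Z + l *\<^sub>R (- d)" and PZ: "P = Z + (1 - l) *\<^sub>R d"
    by (simp_all add: Zl d_def algebra_simps)
  show ?thesis
  proof (intro equalityI subsetI)
    fix x assume x: "x \<in> closed_segment X P"
    then have "x \<in> T" using XT T by (meson closed_segment_subset subsetD)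
    moreover obtain k where "x = X + k *\<^sub>R d" using x by (auto simp: in_segment d_def algebra_simps)
    then have "x - Z = (k - l) *\<^sub>R d" by (simp add: Zl algebra_simps)
    then have "(x - Z) \<bullet> n = 0" using n by (simp add: d_def)
    ultimately show "x \<in> T \<inter> {x. (x - Z) \<bullet> n = 0}" by simp
  next
    fix x assume x: "x \<in> T \<inter> {x. (x - Z) \<bullet> n = 0}"
    then obtain k where "x - Z = k *\<^sub>R d"
      using orthogonal_imp_multiple[of d n "x - Z"] d0 n by (auto simp: d_def)
    then have xk: "x = Z + k *\<^sub>R d" "x = Z + (- k) *\<^sub>R (- d)" by (simp_all add: algebra_simps)
    have "k \<le> 1 - l" using frontier_point_ends_ray[OF T(1) Z(2), of "1 - l" d k] fr l01 x xk PZ by auto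
    moreover have "- k \<le> l" using frontier_point_ends_ray[OF T(1) Z(2), of l "- d" "- k"] fr l01 x xk XZ by auto
    moreover have "x = (1 - (l + k)) *\<^sub>R X + (l + k) *\<^sub>R P"
      by (simp add: xk(1) Zl d_def algebra_simps)
    ultimately show "x \<in> closed_segment X P" unfolding in_segment by (intro exI[of _ "l + k"]) auto
  qed
qed

definition quadrant :: "(real^2) set \<Rightarrow> real^2 \<Rightarrow> real^2 \<Rightarrow> real^2 \<Rightarrow> (real^2) set" where
  "quadrant T Z a b = T \<inter> {x. 0 \<le> (x - Z) \<bullet> a \<and> 0 \<le> (x - Z) \<bullet> b}"

abbreviation signs :: "(real \<times> real) set" where
  "signs \<equiv> {1, -1} \<times> {1, -1}"

section \<open>Regions cut out by two perpendicular lines\<close>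

lemma side_of_line:
  fixes x Z a :: "'a::real_inner"
  shows "0 \<le> (x - Z) \<bullet> a \<longleftrightarrow> a \<bullet> Z \<le> a \<bullet> x" "0 < (x - Z) \<bullet> a \<longleftrightarrow> a \<bullet> Z < a \<bullet> x"
    "0 \<le> (x - Z) \<bullet> (- a) \<longleftrightarrow> a \<bullet> x \<le> a \<bullet> Z" "(x - Z) \<bullet> a = 0 \<longleftrightarrow> a \<bullet> x = a \<bullet> Z"
  unfolding inner_diff_left inner_minus_right inner_commute[of x a] inner_commute[of Z a] by auto

text \<open>
  Segments from a point of the closed piece to a point of the open piece lie in the open piece except
  perhaps for their starting point.
\<close>

lemma closure_open_quadrant:
  fixes T :: "(real^2) set"
  assumes T: "convex T" "closed T" and x: "x \<in> T" "0 < (x - Z) \<bullet> a" "0 < (x - Z) \<bullet> b"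
  shows "closure (T \<inter> {y. 0 < (y - Z) \<bullet> a \<and> 0 < (y - Z) \<bullet> b}) = quadrant T Z a b"
    (is "closure ?O = _")
proof
  have "quadrant T Z a b = T \<inter> ({y. a \<bullet> y \<ge> a \<bullet> Z} \<inter> {y. b \<bullet> y \<ge> b \<bullet> Z})"
    unfolding quadrant_def side_of_line by auto
  then have "closed (quadrant T Z a b)"
    using T(2) by (simp only: closed_Int closed_halfspace_ge)
  moreover have "?O \<subseteq> quadrant T Z a b" by (auto simp: quadrant_def)
  ultimately show "closure ?O \<subseteq> quadrant T Z a b" by (rule closure_minimal[rotated])
  show "quadrant T Z a b \<subseteq> closure ?O"
  proof
    fix y assume y: "y \<in> quadrant T Z a b"
    show "y \<in> closure ?O"
    proof (cases "y = x")
      case True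
      then show ?thesis using x closure_subset by fastforce
    next
      case False
      have "open_segment y x \<subseteq> ?O"
      proof
        fix z assume "z \<in> open_segment y x"
        then obtain k where k: "0 < k" "k < 1" "z = (1 - k) *\<^sub>R y + k *\<^sub>R x" by (auto simp: in_segment)
        have zZ: "z - Z = (1 - k) *\<^sub>R (y - Z) + k *\<^sub>R (x - Z)" by (simp add: k algebra_simps)
        have "z \<in> T" using k y x T(1) by (auto simp: quadrant_def intro: convexD)
        moreover have "0 < (z - Z) \<bullet> a" "0 < (z - Z) \<bullet> b"
          unfolding zZ inner_add_left inner_scaleR_left using k x y
          by (auto simp: quadrant_def intro!: add_nonneg_pos)
        ultimately show "z \<in> ?O" by simp
      qed
      then have "closure (open_segment y x) \<subseteq> closure ?O" by (rule closure_mono)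
      then show ?thesis using False by auto
    qed
  qed
qed

text \<open>
  The open piece is convex, hence connected; and a connected set that leaves it has to meet one of the
  two lines.
\<close>

lemma connected_component_minus_cross:
  fixes T :: "(real^2) set" and Z a b :: "real^2"
  defines "S \<equiv> T - {x. (x - Z) \<bullet> a = 0 \<or> (x - Z) \<bullet> b = 0}"
  assumes T: "convex T" and x: "x \<in> T" "0 < (x - Z) \<bullet> a" "0 < (x - Z) \<bullet> b"
  shows "connected_component_set S x = T \<inter> {y. 0 < (y - Z) \<bullet> a \<and> 0 < (y - Z) \<bullet> b}"
    (is "?C = ?O")
proof
  have "?O = T \<inter> ({y. a \<bullet> y > a \<bullet> Z} \<inter> {y. b \<bullet> y > b \<bullet> Z})"
    unfolding side_of_line by auto
  then have "convex ?O"
    using T by (simp only: convex_Int convex_halfspace_gt)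
  then show "?O \<subseteq> ?C"
    by (intro connected_component_maximal convex_connected) (use x in \<open>auto simp: S_def\<close>)
  show "?C \<subseteq> ?O"
  proof
    fix y assume y: "y \<in> ?C"
    have sub: "?C \<subseteq> S" by (rule connected_component_subset)
    have "x \<in> S" using x by (auto simp: S_def)
    then have xC: "x \<in> ?C" by simp
    have pos: "0 < (y - Z) \<bullet> c" if c: "0 < (x - Z) \<bullet> c" "\<And>z. z \<in> S \<Longrightarrow> (z - Z) \<bullet> c \<noteq> 0" for c
    proof (rule ccontr)
      assume "\<not> ?thesis"
      then have "c \<bullet> y \<le> c \<bullet> Z" "c \<bullet> Z \<le> c \<bullet> x"
        using c(1) unfolding side_of_line by simp_all
      then obtain z where "z \<in> ?C" "c \<bullet> z = c \<bullet> Z"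
        using connected_ivt_hyperplane[OF connected_connected_component y xC] by blast
      then show False using c(2)[of z] sub unfolding side_of_line by auto
    qed
    have "0 < (y - Z) \<bullet> a" "0 < (y - Z) \<bullet> b" using x by (auto intro!: pos simp: S_def)
    moreover have "y \<in> T" using y sub by (auto simp: S_def)
    ultimately show "y \<in> ?O" by simp
  qed
qed

lemma ex_point_in_quadrant:
  fixes T :: "(real^2) set"
  assumes "Z \<in> interior T" "a \<noteq> 0" "b \<noteq> 0" "a \<bullet> b = 0"
  obtains x where "x \<in> T" "0 < (x - Z) \<bullet> a" "0 < (x - Z) \<bullet> b"
proof -
  obtain e where e: "0 < e" "ball Z e \<subseteq> T" using assms(1) mem_interior by blast
  have ab: "a + b \<noteq> 0"
  proof
    assume "a + b = 0"
    then have "(a + b) \<bullet> a = 0" by simp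
    then show False using assms by (simp add: inner_add_left inner_commute[of b a])
  qed
  define k where "k = e / (2 * norm (a + b))"
  have k: "k > 0" using e ab by (simp add: k_def)
  have "dist Z (Z + k *\<^sub>R (a + b)) = e / 2" using k ab e by (simp add: dist_norm k_def)
  then have "Z + k *\<^sub>R (a + b) \<in> T" using e by (auto intro!: subsetD[OF e(2)])
  moreover have "0 < (Z + k *\<^sub>R (a + b) - Z) \<bullet> a" "0 < (Z + k *\<^sub>R (a + b) - Z) \<bullet> b"
    using k assms by (simp_all add: inner_add_left inner_commute[of b a])
  ultimately show ?thesis using that by blast
qed

lemma closure_components_minus_cross:
  fixes T :: "(real^2) set"
  assumes T: "convex T" "closed T" and Z: "Z \<in> interior T"
    and ab: "a \<noteq> 0" "b \<noteq> 0" "a \<bullet> b = 0"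
  shows "closure ` components (T - {x. (x - Z) \<bullet> a = 0 \<or> (x - Z) \<bullet> b = 0})
       = (\<lambda>(s, t). quadrant T Z (s *\<^sub>R a) (t *\<^sub>R b)) ` signs"
    (is "closure ` components ?S = ?f ` _")
proof -
  have main: "closure (connected_component_set ?S x) = quadrant T Z (s *\<^sub>R a) (t *\<^sub>R b)"
    if "x \<in> T" "s \<in> {1, -1}" "t \<in> {1, -1}" "0 < (x - Z) \<bullet> (s *\<^sub>R a)" "0 < (x - Z) \<bullet> (t *\<^sub>R b)" for x s t
  proof -
    have "?S = T - {x. (x - Z) \<bullet> (s *\<^sub>R a) = 0 \<or> (x - Z) \<bullet> (t *\<^sub>R b) = 0}" using that(2,3) by auto
    then show ?thesis
      using connected_component_minus_cross[OF T(1) that(1,4,5)] closure_open_quadrant[OF T that(1,4,5)]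
      by simp
  qed
  show ?thesis
  proof (intro equalityI subsetI)
    fix R assume "R \<in> closure ` components ?S"
    then obtain x where x: "x \<in> ?S" "R = closure (connected_component_set ?S x)"
      by (auto simp: components_def)
    define s t where "s = sgn ((x - Z) \<bullet> a)" and "t = sgn ((x - Z) \<bullet> b)"
    have st: "s \<in> {1, -1}" "t \<in> {1, -1}" using x by (auto simp: s_def t_def sgn_if)
    have "0 < (x - Z) \<bullet> (s *\<^sub>R a)" "0 < (x - Z) \<bullet> (t *\<^sub>R b)"
      using x by (auto simp: s_def t_def sgn_if)
    then have "R = quadrant T Z (s *\<^sub>R a) (t *\<^sub>R b)" using main[of x s t] x st by simp
    then show "R \<in> ?f ` signs" using st by force
  next
    fix R assume "R \<in> ?f ` signs"
    then obtain st where "st \<in> signs" "R = ?f st" by (elim imageE)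
    then obtain s t where st: "s \<in> {1, -1}" "t \<in> {1, -1}" "R = quadrant T Z (s *\<^sub>R a) (t *\<^sub>R b)"
      by (cases st) auto
    obtain x where x: "x \<in> T" "0 < (x - Z) \<bullet> (s *\<^sub>R a)" "0 < (x - Z) \<bullet> (t *\<^sub>R b)"
      by (rule ex_point_in_quadrant[of Z T "s *\<^sub>R a" "t *\<^sub>R b"]) (use Z ab st in auto)
    have "R = closure (connected_component_set ?S x)" using main[of x s t] x st by simp
    moreover have "x \<in> ?S" using x by auto
    ultimately show "R \<in> closure ` components ?S" by (auto simp: components_def)
  qed
qed

lemma inj_on_quadrant:
  fixes T :: "(real^2) set"
  assumes Z: "Z \<in> interior T" and ab: "a \<noteq> 0" "b \<noteq> 0" "a \<bullet> b = 0"
  shows "inj_on (\<lambda>(s, t). quadrant T Z (s *\<^sub>R a) (t *\<^sub>R b)) signs"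
proof -
  have "s = s' \<and> t = t'"
    if st: "s \<in> {1, -1}" "t \<in> {1, -1}" "s' \<in> {1, -1}" "t' \<in> {1, -1}"
      and eq: "quadrant T Z (s *\<^sub>R a) (t *\<^sub>R b) = quadrant T Z (s' *\<^sub>R a) (t' *\<^sub>R b)" for s t s' t' :: real
  proof -
    obtain x where x: "x \<in> T" "0 < (x - Z) \<bullet> (s *\<^sub>R a)" "0 < (x - Z) \<bullet> (t *\<^sub>R b)"
      by (rule ex_point_in_quadrant[of Z T "s *\<^sub>R a" "t *\<^sub>R b"]) (use Z ab st in auto)
    then have "x \<in> quadrant T Z (s' *\<^sub>R a) (t' *\<^sub>R b)" unfolding eq[symmetric] by (simp add: quadrant_def)
    then have "0 \<le> (x - Z) \<bullet> (s' *\<^sub>R a)" "0 \<le> (x - Z) \<bullet> (t' *\<^sub>R b)" by (auto simp: quadrant_def)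
    then show ?thesis using st x by auto
  qed
  note main = this
  show ?thesis
  proof (rule inj_onI)
    fix p q :: "real \<times> real" assume "p \<in> signs" "q \<in> signs"
      "(case p of (s, t) \<Rightarrow> quadrant T Z (s *\<^sub>R a) (t *\<^sub>R b)) = (case q of (s, t) \<Rightarrow> quadrant T Z (s *\<^sub>R a) (t *\<^sub>R b))"
    then have "fst p = fst q \<and> snd p = snd q"
      by (intro main) (auto simp: case_prod_beta)
    then show "p = q" by (simp add: prod_eq_iff)
  qed
qed

section \<open>Cutting along a line\<close>

lemma measure_split_line:
  fixes K :: "(real^2) set"
  assumes "compact K" "n \<noteq> 0"
  shows "measure lebesgue K =
    measure lebesgue (K \<inter> {x. 0 \<le> (x - Z) \<bullet> n}) + measure lebesgue (K \<inter> {x. 0 \<le> (x - Z) \<bullet> (- n)})"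
proof -
  have "negligible {x. n \<bullet> x = n \<bullet> Z}" using assms negligible_hyperplane by blast
  then have neg: "negligible ((K \<inter> {x. n \<bullet> x \<ge> n \<bullet> Z}) \<inter> (K \<inter> {x. n \<bullet> x \<le> n \<bullet> Z}))"
    by (rule negligible_subset) auto
  have "K = (K \<inter> {x. n \<bullet> x \<ge> n \<bullet> Z}) \<union> (K \<inter> {x. n \<bullet> x \<le> n \<bullet> Z})" by auto
  then show ?thesis unfolding side_of_line(1)[of _ Z n] side_of_line(3)[of _ Z n]
    using measure_Un3[of "K \<inter> {x. n \<bullet> x \<ge> n \<bullet> Z}" "lebesgue" "K \<inter> {x. n \<bullet> x \<le> n \<bullet> Z}"]
      negligible_imp_measure0[OF neg] assms(1)
    by (simp add: lmeasurable_compact compact_Int_closed closed_halfspace_ge closed_halfspace_le)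
qed

text \<open>
  The affine function \<open>x \<mapsto> (x - Z) \<bullet> n\<close> vanishes at \<open>X\<close> and \<open>P\<close>, so in the coordinates \<open>k, l\<close> with
  respect to \<open>B - C\<close> and \<open>A - C\<close> it is a positive multiple of \<open>1 - k / u - l / w\<close>.
\<close>

lemma corner_cut:
  fixes A B C n Z :: "real^2"
  assumes X: "X = C + u *\<^sub>R (B - C)" "0 < u" "u \<le> 1"
    and P: "P = C + w *\<^sub>R (A - C)" "0 < w" "w \<le> 1"
    and line: "(X - Z) \<bullet> n = 0" "(P - Z) \<bullet> n = 0" and C: "0 < (C - Z) \<bullet> n"
  shows "convex hull {A, B, C} \<inter> {x. 0 \<le> (x - Z) \<bullet> n} = convex hull {C, X, P}"
proof -
  define g where "g = (C - Z) \<bullet> n"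
  have "X - Z = (C - Z) + u *\<^sub>R (B - C)" "P - Z = (C - Z) + w *\<^sub>R (A - C)"
    unfolding X(1) P(1) by simp_all
  then have gX: "u * ((B - C) \<bullet> n) = - g" and gP: "w * ((A - C) \<bullet> n) = - g"
    using line unfolding g_def by (simp_all only: inner_add_left inner_scaleR_left)
  have BC: "(B - C) \<bullet> n = - g / u" and AC: "(A - C) \<bullet> n = - g / w"
    using gX gP X(2) P(2) by (metis nonzero_mult_div_cancel_left less_irrefl)+
  have val: "(C + k *\<^sub>R (B - C) + l *\<^sub>R (A - C) - Z) \<bullet> n = g * (1 - k / u - l / w)" for k l
  proof -
    have "C + k *\<^sub>R (B - C) + l *\<^sub>R (A - C) - Z = (C - Z) + k *\<^sub>R (B - C) + l *\<^sub>R (A - C)" by simp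
    then have "(C + k *\<^sub>R (B - C) + l *\<^sub>R (A - C) - Z) \<bullet> n = g + k * ((B - C) \<bullet> n) + l * ((A - C) \<bullet> n)"
      by (simp only: g_def inner_add_left inner_scaleR_left)
    then show ?thesis unfolding BC AC by (simp add: algebra_simps)
  qed
  have g: "g > 0" using C by (simp add: g_def)
  have T: "convex hull {A, B, C} = {C + k *\<^sub>R (B - C) + l *\<^sub>R (A - C) | k l. 0 \<le> k \<and> 0 \<le> l \<and> k + l \<le> 1}"
    using convex_hull_3_alt[of C B A] by (simp add: insert_commute)
  have R: "convex hull {C, X, P} = {C + (k * u) *\<^sub>R (B - C) + (l * w) *\<^sub>R (A - C) | k l. 0 \<le> k \<and> 0 \<le> l \<and> k + l \<le> 1}"
    unfolding convex_hull_3_alt X(1) P(1) by (simp add: mult.commute)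
  show ?thesis
  proof (intro equalityI subsetI)
    fix x assume x: "x \<in> convex hull {A, B, C} \<inter> {x. 0 \<le> (x - Z) \<bullet> n}"
    then obtain k l where kl: "0 \<le> k" "0 \<le> l" "x = C + k *\<^sub>R (B - C) + l *\<^sub>R (A - C)" unfolding T by auto
    have "0 \<le> g * (1 - k / u - l / w)" using x val kl by simp
    then have "k / u + l / w \<le> 1" using g by (simp add: zero_le_mult_iff)
    then show "x \<in> convex hull {C, X, P}"
      unfolding R using kl X P by (intro CollectI exI[of _ "k / u"] exI[of _ "l / w"]) auto
  next
    fix x assume x: "x \<in> convex hull {C, X, P}"
    then obtain k l where kl: "0 \<le> k" "0 \<le> l" "k + l \<le> 1" "x = C + (k * u) *\<^sub>R (B - C) + (l * w) *\<^sub>R (A - C)" unfolding R by auto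
    have "k * u \<le> k * 1" "l * w \<le> l * 1" using kl X P by (intro mult_left_mono; simp)+
    then have "x \<in> convex hull {A, B, C}"
      unfolding T using kl X P by (intro CollectI exI[of _ "k * u"] exI[of _ "l * w"]) auto
    moreover have "(x - Z) \<bullet> n = g * (1 - k - l)" using val[of "k * u" "l * w"] kl X P by simp
    then have "0 \<le> (x - Z) \<bullet> n" using g kl by simp
    ultimately show "x \<in> convex hull {A, B, C} \<inter> {x. 0 \<le> (x - Z) \<bullet> n}" by simp
  qed
qed

section \<open>Perpendicular chords through an interior point\<close>

text \<open>
  A quadrisection without its conditions on areas, with the intersection point \<open>Z\<close> as a parameter.
\<close>

definition crossing :: "(real^2) set \<Rightarrow> real^2 \<Rightarrow> real^2 \<Rightarrow> real^2 \<Rightarrow> real^2 \<Rightarrow> real^2 \<Rightarrow> bool" where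
  "crossing T X P Y Q Z \<longleftrightarrow> {X, P, Y, Q} \<subseteq> frontier T \<and> (P - X) \<bullet> (Q - Y) = 0 \<and>
     Z \<in> closed_segment X P \<and> Z \<in> closed_segment Y Q \<and> Z \<in> interior T"

lemma crossing_swap: "crossing T X P Y Q Z \<Longrightarrow> crossing T Y Q X P Z"
  by (auto simp: crossing_def inner_commute)

lemma crossing_point_on_chord:
  assumes "crossing T X P Y Q Z"
  obtains l where "0 < l" "l < 1" "Z = X + l *\<^sub>R (P - X)"
proof -
  have "Z \<in> closed_segment X P" using assms by (simp add: crossing_def)
  then obtain l where l: "0 \<le> l" "l \<le> 1" "Z = (1 - l) *\<^sub>R X + l *\<^sub>R P" by (auto simp: in_segment)
  have "Z \<noteq> X" "Z \<noteq> P" using assms by (auto simp: crossing_def frontier_def)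
  then have "l \<noteq> 0" "l \<noteq> 1" using l by auto
  with l show ?thesis using that[of l] by (auto simp: algebra_simps)
qed

lemma crossing_nonzero:
  assumes "crossing T X P Y Q Z"
  shows "P - X \<noteq> 0"
proof
  assume "P - X = 0"
  then have "Z = X" using crossing_point_on_chord[OF assms] by auto
  then show False using assms by (auto simp: crossing_def frontier_def)
qed

lemma crossing_on_lines:
  assumes "crossing T X P Y Q Z"
  shows "(X - Z) \<bullet> (Q - Y) = 0" "(P - Z) \<bullet> (Q - Y) = 0"
proof -
  obtain l where l: "Z = X + l *\<^sub>R (P - X)" using crossing_point_on_chord[OF assms] by blast
  have o: "(P - X) \<bullet> (Q - Y) = 0" using assms by (simp add: crossing_def)
  have "X - Z = (- l) *\<^sub>R (P - X)" "P - Z = (1 - l) *\<^sub>R (P - X)"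
    by (simp_all add: l algebra_simps)
  then show "(X - Z) \<bullet> (Q - Y) = 0" "(P - Z) \<bullet> (Q - Y) = 0" by (simp_all only: inner_scaleR_left o mult_zero_right)
qed

lemma crossing_chords:
  assumes T: "convex T" "closed T" and cr: "crossing T X P Y Q Z"
  shows "closed_segment X P = T \<inter> {x. (x - Z) \<bullet> (Q - Y) = 0}"
    and "closed_segment Y Q = T \<inter> {x. (x - Z) \<bullet> (P - X) = 0}"
  using chord_eq_line_section[OF T, of X P Z "Q - Y"] chord_eq_line_section[OF T, of Y Q Z "P - X"]
    cr crossing_nonzero[OF cr] crossing_nonzero[OF crossing_swap[OF cr]]
  by (auto simp: crossing_def inner_commute)

lemma crossing_chords_meet:
  assumes T: "convex T" "closed T" and cr: "crossing T X P Y Q Z"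
  shows "closed_segment X P \<inter> closed_segment Y Q = {Z}"
proof -
  have "x = Z" if x: "x \<in> closed_segment X P" "x \<in> closed_segment Y Q" for x
  proof -
    have "(x - Z) \<bullet> (Q - Y) = 0" "(x - Z) \<bullet> (P - X) = 0"
      using x unfolding crossing_chords[OF assms] by auto
    moreover have "(P - X) \<bullet> (Q - Y) = 0" using cr by (simp add: crossing_def)
    moreover have "P - X \<noteq> 0" "Q - Y \<noteq> 0"
      using crossing_nonzero[OF cr] crossing_nonzero[OF crossing_swap[OF cr]] .
    ultimately obtain k where k: "x - Z = k *\<^sub>R (P - X)"
      using orthogonal_imp_multiple by blast
    then have "k * ((P - X) \<bullet> (P - X)) = 0" using \<open>(x - Z) \<bullet> (P - X) = 0\<close> by simp
    then show ?thesis using k \<open>P - X \<noteq> 0\<close> by auto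
  qed
  moreover have "Z \<in> closed_segment X P" "Z \<in> closed_segment Y Q" using cr by (simp_all add: crossing_def)
  ultimately show ?thesis by blast
qed

lemma regions_of_crossing:
  assumes T: "convex T" "closed T" and cr: "crossing T X P Y Q Z"
  shows "regions T {closed_segment X P, closed_segment Y Q}
       = (\<lambda>(s, t). quadrant T Z (s *\<^sub>R (P - X)) (t *\<^sub>R (Q - Y))) ` signs"
    and "card (regions T {closed_segment X P, closed_segment Y Q}) = 4"
proof -
  have d: "P - X \<noteq> 0" "Q - Y \<noteq> 0" "(P - X) \<bullet> (Q - Y) = 0" "Z \<in> interior T"
    using crossing_nonzero[OF cr] crossing_nonzero[OF crossing_swap[OF cr]] cr by (auto simp: crossing_def)
  have "T - \<Union>{closed_segment X P, closed_segment Y Q}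
      = T - {x. (x - Z) \<bullet> (P - X) = 0 \<or> (x - Z) \<bullet> (Q - Y) = 0}"
    unfolding crossing_chords[OF assms] by auto
  then show eq: "regions T {closed_segment X P, closed_segment Y Q}
       = (\<lambda>(s, t). quadrant T Z (s *\<^sub>R (P - X)) (t *\<^sub>R (Q - Y))) ` signs"
    unfolding regions_def using closure_components_minus_cross[OF T d(4,1,2,3)] by simp
  show "card (regions T {closed_segment X P, closed_segment Y Q}) = 4"
    unfolding eq by (subst card_image[OF inj_on_quadrant[OF d(4,1,2,3)]]) (simp add: card_cartesian_product)
qed

lemma measure_quadrants:
  assumes T: "compact T" and ab: "a \<noteq> 0" "b \<noteq> 0"
  shows "measure lebesgue (T \<inter> {x. 0 \<le> (x - Z) \<bullet> a}) =
           measure lebesgue (quadrant T Z a b) + measure lebesgue (quadrant T Z a (- b))"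
    and "measure lebesgue (T \<inter> {x. 0 \<le> (x - Z) \<bullet> b}) =
           measure lebesgue (quadrant T Z a b) + measure lebesgue (quadrant T Z (- a) b)"
proof -
  have c: "compact (T \<inter> {x. 0 \<le> (x - Z) \<bullet> n})" for n
    unfolding side_of_line(1) using T by (intro compact_Int_closed closed_halfspace_ge)
  have "T \<inter> {x. 0 \<le> (x - Z) \<bullet> m} \<inter> {x. 0 \<le> (x - Z) \<bullet> n} = quadrant T Z m n"
    "T \<inter> {x. 0 \<le> (x - Z) \<bullet> m} \<inter> {x. 0 \<le> (x - Z) \<bullet> n} = quadrant T Z n m" for m n
    by (auto simp: quadrant_def)
  then show "measure lebesgue (T \<inter> {x. 0 \<le> (x - Z) \<bullet> a}) =
           measure lebesgue (quadrant T Z a b) + measure lebesgue (quadrant T Z a (- b))"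
    "measure lebesgue (T \<inter> {x. 0 \<le> (x - Z) \<bullet> b}) =
           measure lebesgue (quadrant T Z a b) + measure lebesgue (quadrant T Z (- a) b)"
    using measure_split_line[OF c[of a] ab(2), of Z] measure_split_line[OF c[of b] ab(1), of Z] by metis+
qed

text \<open>
  The form in which equality of the four areas is used: what lies on one side of a segment is the
  union of two regions, so it has half of the area, and on a suitable side it is a triangle,
  whose area is easy to compute. The two signs of each normal vector stand for the two sides of a
  segment.
\<close>

definition quartered :: "(real^2) set \<Rightarrow> real^2 \<Rightarrow> real^2 \<Rightarrow> real^2 \<Rightarrow> real^2 \<Rightarrow> real^2 \<Rightarrow> bool" where
  "quartered T X P Y Q Z \<longleftrightarrow> crossing T X P Y Q Z \<and>
     (\<forall>n \<in> {P - X, X - P, Q - Y, Y - Q}. measure lebesgue (T \<inter> {x. 0 \<le> (x - Z) \<bullet> n}) = measure lebesgue T / 2) \<and>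
     measure lebesgue (convex hull {X, Z, Y}) = measure lebesgue T / 4"

lemma quartered_swap: "quartered T X P Y Q Z \<Longrightarrow> quartered T Y Q X P Z"
  unfolding quartered_def using crossing_swap by (auto simp: insert_commute)

lemma quadrants_of_equal_measure:
  assumes T: "compact T" and ab: "a \<noteq> 0" "b \<noteq> 0"
    and eq: "\<And>s t. s \<in> {1, -1} \<Longrightarrow> t \<in> {1, -1} \<Longrightarrow> measure lebesgue (quadrant T Z (s *\<^sub>R a) (t *\<^sub>R b)) = \<mu>"
  shows "measure lebesgue T = 4 * \<mu>"
    and "\<forall>n \<in> {a, - a, b, - b}. measure lebesgue (T \<inter> {x. 0 \<le> (x - Z) \<bullet> n}) = 2 * \<mu>"
proof -
  have q: "measure lebesgue (quadrant T Z a b) = \<mu>" "measure lebesgue (quadrant T Z a (- b)) = \<mu>"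
     "measure lebesgue (quadrant T Z (- a) b) = \<mu>" "measure lebesgue (quadrant T Z (- a) (- b)) = \<mu>"
    using eq[of 1 1] eq[of 1 "-1"] eq[of "-1" 1] eq[of "-1" "-1"] by simp_all
  show h: "\<forall>n \<in> {a, - a, b, - b}. measure lebesgue (T \<inter> {x. 0 \<le> (x - Z) \<bullet> n}) = 2 * \<mu>"
    using measure_quadrants[OF T ab, of Z] measure_quadrants[OF T, of "- a" b Z]
      measure_quadrants[OF T, of a "- b" Z] measure_quadrants[OF T, of "- a" "- b" Z] ab q by simp
  then show "measure lebesgue T = 4 * \<mu>"
    using measure_split_line[OF T ab(1), of Z] by simp
qed

text \<open>
  The segments witnessing the triangular portion and those witnessing the quadrisection are the same
  up to exchanging them and reversing each of them; perpendicularity is insensitive to both.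
\<close>

lemma quadrisection_imp_quartered:
  assumes T: "convex T" "compact T" and q: "quadrisection T q" "triangular_portion_on T q s"
  obtains X P Y Q Z where "q = {closed_segment X P, closed_segment Y Q}" "X \<in> s" "Y \<in> s"
    "quartered T X P Y Q Z"
proof -
  obtain X P Y Q Z where *: "q = {closed_segment X P, closed_segment Y Q}" "X \<in> s" "Y \<in> s"
     "closed_segment X P \<inter> closed_segment Y Q = {Z}" "convex hull {X, Z, Y} \<in> regions T q"
    using q(2) unfolding triangular_portion_on_def by blast
  obtain X' P' Y' Q' Z' where **: "q = {closed_segment X' P', closed_segment Y' Q'}"
     "{X', P', Y', Q'} \<subseteq> frontier T" "orthogonal (P' - X') (Q' - Y')"
     "closed_segment X' P' \<inter> closed_segment Y' Q' = {Z'}" "Z' \<in> interior T"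
     "\<forall>R \<in> regions T q. \<forall>R' \<in> regions T q. measure lebesgue R = measure lebesgue R'"
    using q(1) unfolding quadrisection_def by blast
  have o: "(P' - X') \<bullet> (Q' - Y') = 0" using **(3) by (simp add: orthogonal_def)
  have "(closed_segment X P = closed_segment X' P' \<and> closed_segment Y Q = closed_segment Y' Q') \<or>
     (closed_segment X P = closed_segment Y' Q' \<and> closed_segment Y Q = closed_segment X' P')"
    using *(1) **(1) by (metis doubleton_eq_iff)
  then have c: "crossing T X P Y Q Z"
  proof
    assume a: "closed_segment X P = closed_segment X' P' \<and> closed_segment Y Q = closed_segment Y' Q'"
    then have "Z = Z'" using *(4) **(4) by (metis singleton_inject Int_commute)
    moreover have "(P - X) \<bullet> (Q - Y) = 0"
      using a o by (auto simp: doubleton_eq_iff inner_diff_left inner_diff_right)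
    moreover have "{X, P, Y, Q} \<subseteq> frontier T" using a **(2) by (auto simp: doubleton_eq_iff)
    ultimately show ?thesis using *(4) **(5) by (auto simp: crossing_def)
  next
    assume a: "closed_segment X P = closed_segment Y' Q' \<and> closed_segment Y Q = closed_segment X' P'"
    then have "Z = Z'" using *(4) **(4) by (metis singleton_inject Int_commute)
    moreover have "(P - X) \<bullet> (Q - Y) = 0"
      using a o by (auto simp: doubleton_eq_iff inner_diff_left inner_diff_right inner_commute)
    moreover have "{X, P, Y, Q} \<subseteq> frontier T" using a **(2) by (auto simp: doubleton_eq_iff)
    ultimately show ?thesis using *(4) **(5) by (auto simp: crossing_def)
  qed
  define \<mu> where "\<mu> = measure lebesgue (convex hull {X, Z, Y})"
  have d: "P - X \<noteq> 0" "Q - Y \<noteq> 0" using crossing_nonzero[OF c] crossing_nonzero[OF crossing_swap[OF c]] .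
  have "measure lebesgue (quadrant T Z (s *\<^sub>R (P - X)) (t *\<^sub>R (Q - Y))) = \<mu>"
    if st: "s \<in> {1, -1}" "t \<in> {1, -1}" for s t
  proof -
    have "quadrant T Z (s *\<^sub>R (P - X)) (t *\<^sub>R (Q - Y)) \<in> regions T q"
      unfolding *(1) regions_of_crossing(1)[OF T(1) compact_imp_closed[OF T(2)] c] using st by force
    then show ?thesis unfolding \<mu>_def using **(6) *(5) by blast
  qed
  note m = quadrants_of_equal_measure[OF T(2) d this]
  have "quartered T X P Y Q Z"
    unfolding quartered_def using c m by (auto simp flip: \<mu>_def)
  then show ?thesis using * that by blast
qed

text \<open>
  If both segments halve the area and one of the four regions has a quarter of it, then so do the two
  neighbours of that region, and hence also the opposite region.
\<close>

lemma quadrisection_of_crossing: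
  assumes T: "convex T" "compact T" and c: "crossing T X P Y Q Z" and s: "X \<in> s" "Y \<in> s"
    and half: "measure lebesgue (T \<inter> {x. 0 \<le> (x - Z) \<bullet> (\<sigma> *\<^sub>R (P - X))}) = measure lebesgue T / 2"
      "measure lebesgue (T \<inter> {x. 0 \<le> (x - Z) \<bullet> (\<tau> *\<^sub>R (Q - Y))}) = measure lebesgue T / 2"
    and \<sigma>\<tau>: "\<sigma> \<in> {1, -1}" "\<tau> \<in> {1, -1}"
    and tri: "quadrant T Z (\<sigma>' *\<^sub>R (P - X)) (\<tau>' *\<^sub>R (Q - Y)) = convex hull {X, Z, Y}"
      "\<sigma>' \<in> {1, -1}" "\<tau>' \<in> {1, -1}"
      "measure lebesgue (convex hull {X, Z, Y}) = measure lebesgue T / 4"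
  shows "quadrisection T {closed_segment X P, closed_segment Y Q}"
    and "triangular_portion_on T {closed_segment X P, closed_segment Y Q} s"
proof -
  let ?q = "{closed_segment X P, closed_segment Y Q}"
  note reg = regions_of_crossing[OF T(1) compact_imp_closed[OF T(2)] c]
  note meet = crossing_chords_meet[OF T(1) compact_imp_closed[OF T(2)] c]
  define a b where "a = P - X" and "b = Q - Y"
  have d: "a \<noteq> 0" "b \<noteq> 0"
    using crossing_nonzero[OF c] crossing_nonzero[OF crossing_swap[OF c]] by (simp_all add: a_def b_def)
  let ?m = "measure lebesgue T"
  let ?h = "\<lambda>n. measure lebesgue (T \<inter> {x. 0 \<le> (x - Z) \<bullet> n})"
  have "?h a = ?m / 2" "?h (- a) = ?m / 2"
    using half(1) \<sigma>\<tau>(1) measure_split_line[OF T(2) d(1), of Z] by (auto simp flip: a_def)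
  moreover have "?h b = ?m / 2" "?h (- b) = ?m / 2"
    using half(2) \<sigma>\<tau>(2) measure_split_line[OF T(2) d(2), of Z] by (auto simp flip: b_def)
  ultimately have sums:
    "measure lebesgue (quadrant T Z a b) + measure lebesgue (quadrant T Z a (- b)) = ?m / 2"
    "measure lebesgue (quadrant T Z (- a) b) + measure lebesgue (quadrant T Z (- a) (- b)) = ?m / 2"
    "measure lebesgue (quadrant T Z a b) + measure lebesgue (quadrant T Z (- a) b) = ?m / 2"
    "measure lebesgue (quadrant T Z a (- b)) + measure lebesgue (quadrant T Z (- a) (- b)) = ?m / 2"
    using measure_quadrants[OF T(2) d, of Z] measure_quadrants(1)[OF T(2), of "- a" b Z]
      measure_quadrants(2)[OF T(2), of a "- b" Z] d by simp_all
  moreover have "measure lebesgue (quadrant T Z (\<sigma>' *\<^sub>R a) (\<tau>' *\<^sub>R b)) = ?m / 4"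
    using tri(1,4) by (simp add: a_def b_def)
  moreover have "(\<sigma>' = 1 \<or> \<sigma>' = -1) \<and> (\<tau>' = 1 \<or> \<tau>' = -1)" using tri(2,3) by auto
  ultimately have "measure lebesgue (quadrant T Z a b) = ?m / 4 \<and> measure lebesgue (quadrant T Z a (- b)) = ?m / 4 \<and>
     measure lebesgue (quadrant T Z (- a) b) = ?m / 4 \<and> measure lebesgue (quadrant T Z (- a) (- b)) = ?m / 4"
    by (elim conjE disjE) simp_all
  then have q: "measure lebesgue (quadrant T Z (s *\<^sub>R a) (t *\<^sub>R b)) = ?m / 4"
    if "s \<in> {1, -1}" "t \<in> {1, -1}" for s t
    using that by auto
  have reg_eq: "measure lebesgue R = ?m / 4" if R: "R \<in> regions T ?q" for R
  proof -
    obtain st where "st \<in> signs" "R = (case st of (s, t) \<Rightarrow> quadrant T Z (s *\<^sub>R a) (t *\<^sub>R b))"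
      using R unfolding reg(1) a_def[symmetric] b_def[symmetric] by (elim imageE)
    then show ?thesis using q[of "fst st" "snd st"] by (auto simp: case_prod_beta)
  qed
  have "\<forall>R \<in> regions T ?q. \<forall>R' \<in> regions T ?q. measure lebesgue R = measure lebesgue R'"
    using reg_eq by metis
  moreover have "{X, P, Y, Q} \<subseteq> frontier T" "orthogonal (P - X) (Q - Y)" "Z \<in> interior T"
    using c by (simp_all only: crossing_def orthogonal_def)
  ultimately show "quadrisection T ?q"
    unfolding quadrisection_def using meet reg(2) by blast
  have "convex hull {X, Z, Y} \<in> regions T ?q"
    unfolding reg(1) by (rule image_eqI[of _ _ "(\<sigma>', \<tau>')"]) (use tri in auto)
  then show "triangular_portion_on T ?q s"
    unfolding triangular_portion_on_def using s meet by blast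
qed

section \<open>Coordinates in a triangle\<close>

lemma cross2_linear:
  "cross2 (x + y) z = cross2 x z + cross2 y z" "cross2 z (x + y) = cross2 z x + cross2 z y"
  "cross2 (x - y) z = cross2 x z - cross2 y z" "cross2 z (x - y) = cross2 z x - cross2 z y"
  "cross2 (k *\<^sub>R x) z = k * cross2 x z" "cross2 z (k *\<^sub>R x) = k * cross2 z x"
  "cross2 x x = 0"
  by (simp_all add: cross2_def algebra_simps)

lemma cross2_skew: "cross2 y x = - cross2 x y"
  by (simp add: cross2_def)

lemma basis_coordinates_unique:
  assumes "cross2 e f \<noteq> 0" "k *\<^sub>R e + l *\<^sub>R f = k' *\<^sub>R e + l' *\<^sub>R f"
  shows "k = k'" "l = l'"
proof -
  have "cross2 (k *\<^sub>R e + l *\<^sub>R f) f = cross2 (k' *\<^sub>R e + l' *\<^sub>R f) f"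
    "cross2 e (k *\<^sub>R e + l *\<^sub>R f) = cross2 e (k' *\<^sub>R e + l' *\<^sub>R f)" by (simp_all only: assms(2))
  then show "k = k'" "l = l'" using assms(1) by (simp_all add: cross2_linear)
qed

lemma measure_triangle_in_coordinates:
  fixes A B C :: "real^2"
  shows "measure lebesgue (convex hull {C + k1 *\<^sub>R (B - C) + l1 *\<^sub>R (A - C), C + k2 *\<^sub>R (B - C) + l2 *\<^sub>R (A - C),
      C + k3 *\<^sub>R (B - C) + l3 *\<^sub>R (A - C)})
   = \<bar>(k2 - k1) * (l3 - l1) - (l2 - l1) * (k3 - k1)\<bar> * measure lebesgue (convex hull {A, B, C})"
proof -
  define e f where "e = B - C" and "f = A - C"
  have "cross2 (C + k2 *\<^sub>R e + l2 *\<^sub>R f - (C + k1 *\<^sub>R e + l1 *\<^sub>R f))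
      (C + k3 *\<^sub>R e + l3 *\<^sub>R f - (C + k1 *\<^sub>R e + l1 *\<^sub>R f))
      = cross2 ((k2 - k1) *\<^sub>R e + (l2 - l1) *\<^sub>R f) ((k3 - k1) *\<^sub>R e + (l3 - l1) *\<^sub>R f)"
    by (simp add: algebra_simps)
  also have "\<dots> = ((k2 - k1) * (l3 - l1) - (l2 - l1) * (k3 - k1)) * cross2 e f"
    by (simp add: cross2_linear cross2_skew[of f e] algebra_simps)
  finally have 1: "cross2 (C + k2 *\<^sub>R e + l2 *\<^sub>R f - (C + k1 *\<^sub>R e + l1 *\<^sub>R f))
      (C + k3 *\<^sub>R e + l3 *\<^sub>R f - (C + k1 *\<^sub>R e + l1 *\<^sub>R f))
      = ((k2 - k1) * (l3 - l1) - (l2 - l1) * (k3 - k1)) * cross2 e f" .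
  have "convex hull {A, B, C} = convex hull {C, B, A}" by (simp add: insert_commute)
  then have 2: "measure lebesgue (convex hull {A, B, C}) = \<bar>cross2 e f\<bar> / 2"
    by (simp add: measure_triangle e_def f_def)
  show ?thesis unfolding 2 unfolding measure_triangle e_def[symmetric] f_def[symmetric] 1 by (simp add: abs_mult)
qed

lemma measure_triangle_pos:
  assumes "\<not> collinear {A, B, C :: real^2}"
  shows "measure lebesgue (convex hull {A, B, C}) > 0"
  using cross2_nonzero[OF assms] by (simp add: measure_triangle)

text \<open>
  The corner \<open>C\<close> is not on the line through \<open>X\<close> and \<open>P\<close>; the sign \<open>s\<close> orients the normal vector
  towards it.
\<close>

lemma measure_corner_cut:
  assumes nc: "\<not> collinear {A, B, C :: real^2}"
    and X: "X = C + u *\<^sub>R (B - C)" "0 < u" "u \<le> 1"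
    and P: "P = C + w *\<^sub>R (A - C)" "0 < w" "w \<le> 1"
    and line: "(X - Z) \<bullet> n = 0" "(P - Z) \<bullet> n = 0" and n: "n \<noteq> 0"
  obtains s where "s \<in> {1, -1}"
    "convex hull {A, B, C} \<inter> {x. 0 \<le> (x - Z) \<bullet> (s *\<^sub>R n)} = convex hull {C, X, P}"
    "measure lebesgue (convex hull {A, B, C} \<inter> {x. 0 \<le> (x - Z) \<bullet> (s *\<^sub>R n)}) =
      u * w * measure lebesgue (convex hull {A, B, C})"
proof -
  \<comment> \<open>Otherwise \<open>n\<close> would be orthogonal to two sides of the triangle.\<close>
  have "(C - Z) \<bullet> n \<noteq> 0"
  proof
    assume 0: "(C - Z) \<bullet> n = 0"
    have "u *\<^sub>R (B - C) = (X - Z) - (C - Z)" "w *\<^sub>R (A - C) = (P - Z) - (C - Z)" by (simp_all add: X P)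
    then have "(u *\<^sub>R (B - C)) \<bullet> n = 0" "(w *\<^sub>R (A - C)) \<bullet> n = 0"
      using 0 line by (simp_all only: inner_diff_left)
    then have z: "(B - C) \<bullet> n = 0" "(A - C) \<bullet> n = 0" using X P by simp_all
    have "{C, B, A} = {A, B, C}" by auto
    then have c: "cross2 (B - C) (A - C) \<noteq> 0" using cross2_nonzero[of C B A] nc by simp
    then have "B - C \<noteq> 0" by (auto simp: cross2_def)
    then obtain k where "A - C = k *\<^sub>R (B - C)" using orthogonal_imp_multiple n z by blast
    then show False using c by (simp add: cross2_linear)
  qed
  then obtain s where s: "s \<in> {1, -1}" "0 < (C - Z) \<bullet> (s *\<^sub>R n)"
    by (cases "(C - Z) \<bullet> n > 0") (force intro: that[of 1], force intro: that[of "-1"])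
  have cut: "convex hull {A, B, C} \<inter> {x. 0 \<le> (x - Z) \<bullet> (s *\<^sub>R n)} = convex hull {C, X, P}"
    using line s by (intro corner_cut[OF X P]) auto
  have "measure lebesgue (convex hull {C, X, P}) = u * w * measure lebesgue (convex hull {A, B, C})"
    using measure_triangle_in_coordinates[of C 0 B 0 A u 0 0 w] X P by simp
  then show ?thesis using that[OF s(1) cut] cut by simp
qed

section \<open>Quadrisections as points of the arc\<close>

lemma frontier_triangle:
  fixes A B C :: "real^2"
  shows "frontier (convex hull {A, B, C}) = closed_segment A B \<union> closed_segment B C \<union> closed_segment C A"
  by (rule frontier_of_triangle) simp

lemma point_in_closed_segment:
  fixes a b :: "'a::real_vector"
  assumes "0 \<le> k" "k \<le> 1"
  shows "a + k *\<^sub>R (b - a) \<in> closed_segment a b"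
  unfolding in_segment using assms by (intro exI[of _ k]) (simp add: algebra_simps)

lemma chord_not_within_side:
  assumes "crossing T X P Y Q Z" "X \<in> S" "P \<in> S" "convex S" "S \<subseteq> frontier T"
  shows False
proof -
  have "Z \<in> closed_segment X P" using assms by (simp add: crossing_def)
  then have "Z \<in> S" using assms by (meson closed_segment_subset subsetD)
  then show False using assms by (auto simp: crossing_def frontier_def)
qed

text \<open>
  The corner cut off at \<open>C\<close> has the fraction \<open>u * w\<close> of the area, where \<open>u\<close> and \<open>w\<close> are the relative
  distances of \<open>X\<close> and \<open>P\<close> from \<open>C\<close>; as this fraction is a half, \<open>u\<close> determines \<open>w\<close>, and
  \<open>w \<le> 1\<close> gives \<open>u \<ge> 1/2\<close>.
\<close>

lemma bisecting_chord:
  fixes A B C :: "real^2"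
  assumes nc: "\<not> collinear {A, B, C}" and q: "quartered (convex hull {A, B, C}) X P Y Q Z"
    and X: "X \<in> closed_segment B C" and P: "P \<in> closed_segment C A"
  obtains u where "1/2 \<le> u" "u \<le> 1" "X = C + u *\<^sub>R (B - C)" "P = C + (1 / (2 * u)) *\<^sub>R (A - C)"
proof -
  let ?T = "convex hull {A, B, C}"
  have c: "crossing ?T X P Y Q Z" using q by (simp add: quartered_def)
  have "X \<in> closed_segment C B" using X by (simp add: closed_segment_commute)
  then obtain u where u: "0 \<le> u" "u \<le> 1" "X = C + u *\<^sub>R (B - C)"
    by (auto simp: in_segment algebra_simps)
  obtain w where w: "0 \<le> w" "w \<le> 1" "P = C + w *\<^sub>R (A - C)"
    using P by (auto simp: in_segment algebra_simps)
  have "u \<noteq> 0"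
  proof
    assume "u = 0"
    then show False using chord_not_within_side[OF c _ P] u frontier_triangle[of A B C] by auto
  qed
  moreover have "w \<noteq> 0"
  proof
    assume "w = 0"
    then show False using chord_not_within_side[OF c X] w frontier_triangle[of A B C] by auto
  qed
  ultimately have "0 < u" "0 < w" using u w by auto
  then obtain s where s: "s \<in> {1, -1}"
    "measure lebesgue (?T \<inter> {x. 0 \<le> (x - Z) \<bullet> (s *\<^sub>R (Q - Y))}) = u * w * measure lebesgue ?T"
    using measure_corner_cut[OF nc u(3) _ u(2) w(3) _ w(2) crossing_on_lines[OF c]
        crossing_nonzero[OF crossing_swap[OF c]]] by blast
  have "s *\<^sub>R (Q - Y) \<in> {P - X, X - P, Q - Y, Y - Q}" using s by auto
  then have "u * w * measure lebesgue ?T = measure lebesgue ?T / 2"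
    using q s unfolding quartered_def by metis
  then have uw: "u * w = 1/2" using measure_triangle_pos[OF nc] by simp
  then have "w = 1 / (2 * u)" using \<open>u \<noteq> 0\<close> by (simp add: field_simps)
  moreover have "u * w \<le> u * 1" using u w by (intro mult_left_mono) auto
  then have "1/2 \<le> u" using uw by simp
  ultimately show ?thesis using that[of u] u w by simp
qed

text \<open>
  If both segments end on \<open>CA\<close>, with parameters \<open>u\<close> and \<open>v\<close>, their intersection has height
  \<open>h = 1 / (2 * (u + v))\<close> over \<open>BC\<close>, relative to the height of the triangle. Then the triangular
  portion has the fraction \<open>\<bar>u - v\<bar> / (2 * (u + v))\<close> of the area, and if this is a quarter, one of
  \<open>u, v\<close> is three times the other. But both lie between a half and 1.
\<close>

lemma no_quartering_towards_one_side:
  fixes A B C :: "real^2"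
  assumes nc: "\<not> collinear {A, B, C}" and q: "quartered (convex hull {A, B, C}) X P Y Q Z"
    and XY: "X \<in> closed_segment B C" "Y \<in> closed_segment B C"
    and PQ: "P \<in> closed_segment C A" "Q \<in> closed_segment C A"
  shows False
proof -
  let ?T = "convex hull {A, B, C}"
  note q' = quartered_swap[OF q]
  have c: "crossing ?T X P Y Q Z" using q by (simp add: quartered_def)
  obtain u where u: "1/2 \<le> u" "u \<le> 1" "X = C + u *\<^sub>R (B - C)" "P = C + (1 / (2 * u)) *\<^sub>R (A - C)"
    using bisecting_chord[OF nc q XY(1) PQ(1)] .
  obtain v where v: "1/2 \<le> v" "v \<le> 1" "Y = C + v *\<^sub>R (B - C)" "Q = C + (1 / (2 * v)) *\<^sub>R (A - C)"
    using bisecting_chord[OF nc q' XY(2) PQ(2)] .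
  obtain k where k: "Z = X + k *\<^sub>R (P - X)" using crossing_point_on_chord[OF c] by blast
  obtain l where l: "Z = Y + l *\<^sub>R (Q - Y)" using crossing_point_on_chord[OF crossing_swap[OF c]] by blast
  define e f where "e = B - C" and "f = A - C"
  have "{C, B, A} = {A, B, C}" by auto
  then have ef: "cross2 e f \<noteq> 0" using cross2_nonzero[of C B A] nc by (simp add: e_def f_def)
  have Z1: "Z = C + (u - k * u) *\<^sub>R e + (k / (2 * u)) *\<^sub>R f"
    unfolding k u(3,4) e_def[symmetric] f_def[symmetric] by (simp add: algebra_simps)
  have Z2: "Z = C + (v - l * v) *\<^sub>R e + (l / (2 * v)) *\<^sub>R f"
    unfolding l v(3,4) e_def[symmetric] f_def[symmetric] by (simp add: algebra_simps)
  have eq: "u - k * u = v - l * v" "k / (2 * u) = l / (2 * v)"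
    using basis_coordinates_unique[OF ef, of "u - k * u" "k / (2 * u)" "v - l * v" "l / (2 * v)"] Z1 Z2
    by (simp_all add: add.assoc)
  define h where "h = k / (2 * u)"
  have kl: "k = 2 * u * h" "l = 2 * v * h" using u v by (simp add: h_def, simp add: h_def eq(2))
  have "measure lebesgue (convex hull {X, Z, Y}) = \<bar>- (h * (v - u))\<bar> * measure lebesgue ?T"
    using measure_triangle_in_coordinates[of C u B 0 A "u - k * u" h v 0] u v Z1
    by (simp add: h_def e_def f_def)
  then have area: "\<bar>h * (v - u)\<bar> = 1/4" using q measure_triangle_pos[OF nc] by (simp add: quartered_def)
  then have "u \<noteq> v" by auto
  have "(u - v) * (1 - 2 * h * (u + v)) = 0" using eq(1) unfolding kl by (simp add: algebra_simps)
  then have h: "2 * h * (u + v) = 1" using \<open>u \<noteq> v\<close> by simp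
  have "\<bar>2 * h * (u + v) * (v - u)\<bar> = 2 * (u + v) * \<bar>h * (v - u)\<bar>"
    using u v by (simp add: abs_mult)
  then have "\<bar>v - u\<bar> = (u + v) / 2" unfolding h area by simp
  then show False using u(1,2) v(1,2) by (auto simp: abs_if split: if_splits)
qed

text \<open>
  The first segment cuts off a corner at \<open>C\<close> and the second one a corner at \<open>B\<close>, each of half the
  area. The parameters measure on \<open>BC\<close>, in units of its length, the distance of the endpoint from
  that corner, so the two endpoints have distance \<open>u + v - 1\<close> when the corners overlap.
\<close>

definition cutting_pair :: "real^2 \<Rightarrow> real^2 \<Rightarrow> real^2 \<Rightarrow> real \<Rightarrow> real \<Rightarrow> (real^2) set set" where
  "cutting_pair A B C u v =
     {closed_segment (C + u *\<^sub>R (B - C)) (C + (1 / (2 * u)) *\<^sub>R (A - C)),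
      closed_segment (B + v *\<^sub>R (C - B)) (B + (1 / (2 * v)) *\<^sub>R (A - B))}"

lemma perp_defect_eq_inner:
  fixes A B C :: "real^2"
  assumes "u \<noteq> 0" "v \<noteq> 0"
  shows "perp_defect (dist B C) (dist C A) (dist A B) u v =
    - 8 * u * v * (((C + (1 / (2 * u)) *\<^sub>R (A - C)) - (C + u *\<^sub>R (B - C))) \<bullet>
                   ((B + (1 / (2 * v)) *\<^sub>R (A - B)) - (B + v *\<^sub>R (C - B))))"
proof -
  define e f where "e = B - C" and "f = A - C"
  have P: "(C + (1 / (2 * u)) *\<^sub>R (A - C)) - (C + u *\<^sub>R (B - C)) = (1 / (2 * u)) *\<^sub>R (f - (2 * u\<^sup>2) *\<^sub>R e)"
    using assms by (simp add: e_def f_def algebra_simps power2_eq_square)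
  have AB: "A - B = f - e" and CB: "C - B = - e" by (simp_all add: e_def f_def)
  have Q: "(B + (1 / (2 * v)) *\<^sub>R (A - B)) - (B + v *\<^sub>R (C - B)) = (1 / (2 * v)) *\<^sub>R (f - e + (2 * v\<^sup>2) *\<^sub>R e)"
    unfolding AB CB using assms by (simp add: algebra_simps power2_eq_square)
  have d: "(dist B C)\<^sup>2 = e \<bullet> e" "(dist C A)\<^sup>2 = f \<bullet> f" "(dist A B)\<^sup>2 = (f - e) \<bullet> (f - e)"
    by (simp_all add: dist_norm power2_norm_eq_inner e_def f_def norm_minus_commute[of C A])
  have "- 8 * u * v * ((1 / (2 * u)) *\<^sub>R (f - (2 * u\<^sup>2) *\<^sub>R e) \<bullet> (1 / (2 * v)) *\<^sub>R (f - e + (2 * v\<^sup>2) *\<^sub>R e))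
      = - 2 * ((f - (2 * u\<^sup>2) *\<^sub>R e) \<bullet> (f - e + (2 * v\<^sup>2) *\<^sub>R e))"
    using assms by simp
  also have "\<dots> = perp_defect (dist B C) (dist C A) (dist A B) u v"
    unfolding perp_defect_def d
    by (simp add: inner_diff_left inner_diff_right inner_add_right inner_commute[of f e] algebra_simps)
  finally show ?thesis unfolding P Q by simp
qed

text \<open>
  In coordinates with respect to \<open>B - C\<close> and \<open>A - C\<close> the intersection \<open>Z\<close> has height \<open>h\<close> with
  \<open>h * (2 * u\<^sup>2 + 2 * v\<^sup>2 - 1) = u + v - 1\<close>, and the triangular portion has the fraction
  \<open>h * (u + v - 1)\<close> of the area. Setting the latter to a quarter and eliminating \<open>h\<close> gives the
  equation of \<open>admissible\<close>.
\<close>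

lemma quartered_imp_admissible:
  fixes A B C :: "real^2"
  assumes nc: "\<not> collinear {A, B, C}" and q: "quartered (convex hull {A, B, C}) X P Y Q Z"
    and XY: "X \<in> closed_segment B C" "Y \<in> closed_segment B C"
    and PQ: "P \<in> closed_segment C A" "Q \<in> closed_segment A B"
  obtains u v where "admissible u v" "perp_defect (dist B C) (dist C A) (dist A B) u v = 0"
    "{closed_segment X P, closed_segment Y Q} = cutting_pair A B C u v"
proof -
  let ?T = "convex hull {A, B, C}"
  have c: "crossing ?T X P Y Q Z" using q by (simp add: quartered_def)
  have perm: "{A, C, B} = {A, B, C}" "{C, B, A} = {A, B, C}" by auto
  have nc': "\<not> collinear {A, C, B}" using nc perm by simp
  have q': "quartered (convex hull {A, C, B}) Y Q X P Z" unfolding perm by (rule quartered_swap[OF q])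
  have s': "Y \<in> closed_segment C B" "Q \<in> closed_segment B A" using XY PQ by (simp_all add: closed_segment_commute)
  obtain u where u: "1/2 \<le> u" "u \<le> 1" "X = C + u *\<^sub>R (B - C)" "P = C + (1 / (2 * u)) *\<^sub>R (A - C)"
    using bisecting_chord[OF nc q XY(1) PQ(1)] .
  obtain v where v: "1/2 \<le> v" "v \<le> 1" "Y = B + v *\<^sub>R (C - B)" "Q = B + (1 / (2 * v)) *\<^sub>R (A - B)"
    using bisecting_chord[OF nc' q' s'] .
  obtain k where k: "0 < k" "Z = X + k *\<^sub>R (P - X)" using crossing_point_on_chord[OF c] by blast
  obtain l where l: "Z = Y + l *\<^sub>R (Q - Y)" using crossing_point_on_chord[OF crossing_swap[OF c]] by blast
  define e f where "e = B - C" and "f = A - C"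
  have ef: "cross2 e f \<noteq> 0" using cross2_nonzero[of C B A] nc perm by (simp add: e_def f_def)
  have Z1: "Z = C + (u - k * u) *\<^sub>R e + (k / (2 * u)) *\<^sub>R f"
    unfolding k u(3,4) e_def[symmetric] f_def[symmetric] by (simp add: algebra_simps)
  have B: "B = C + e" "C - B = - e" "A - B = f - e" by (simp_all add: e_def f_def)
  have Y: "Y = C + (1 - v) *\<^sub>R e" unfolding v(3) B by (simp add: B(1) algebra_simps)
  have Q: "Q = C + (1 - 1 / (2 * v)) *\<^sub>R e + (1 / (2 * v)) *\<^sub>R f" unfolding v(4) B(3) by (simp add: B(1) algebra_simps)
  have Z2: "Z = C + (1 - v + l * (v - 1 / (2 * v))) *\<^sub>R e + (l / (2 * v)) *\<^sub>R f"
    unfolding l Y Q by (simp add: algebra_simps)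
  have eq: "u - k * u = 1 - v + l * (v - 1 / (2 * v))" "k / (2 * u) = l / (2 * v)"
    using basis_coordinates_unique[OF ef, of "u - k * u" "k / (2 * u)" "1 - v + l * (v - 1 / (2 * v))" "l / (2 * v)"] Z1 Z2
    by (simp_all add: add.assoc)
  define h where "h = k / (2 * u)"
  have kl: "k = 2 * u * h" "l = 2 * v * h" using u v by (simp add: h_def, simp add: h_def eq(2))
  have h0: "h > 0" using k u by (simp add: h_def)
  have lv: "l * (v - 1 / (2 * v)) = 2 * v\<^sup>2 * h - h" unfolding kl(2) using v by (simp add: field_simps power2_eq_square)
  have h: "h * (2 * u\<^sup>2 + 2 * v\<^sup>2 - 1) = u + v - 1"
    using eq(1)[unfolded lv, unfolded kl(1)] by (simp add: algebra_simps power2_eq_square)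
  have "measure lebesgue (convex hull {X, Z, Y}) = \<bar>- (h * ((1 - v) - u))\<bar> * measure lebesgue ?T"
    using measure_triangle_in_coordinates[of C u B 0 A "u - k * u" h "1 - v" 0] u Y Z1
    by (simp add: h_def e_def f_def)
  then have "\<bar>- (h * ((1 - v) - u))\<bar> = 1/4" using q measure_triangle_pos[OF nc] by (simp add: quartered_def)
  moreover have "\<bar>- (h * ((1 - v) - u))\<bar> = h * (u + v - 1)" using u(1) v(1) h0 by (simp add: abs_mult)
  ultimately have area: "h * (u + v - 1) = 1/4" by simp
  have "u + v > 1"
  proof -
    have "0 < h * (u + v - 1)" using area by simp
    then show ?thesis using h0 by (simp add: zero_less_mult_iff)
  qed
  moreover have "4 * (u + v - 1)\<^sup>2 = 2 * u\<^sup>2 + 2 * v\<^sup>2 - 1"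
  proof -
    have "h * (4 * (u + v - 1)\<^sup>2) = 4 * (h * (u + v - 1)) * (u + v - 1)" by (simp add: power2_eq_square)
    also have "\<dots> = h * (2 * u\<^sup>2 + 2 * v\<^sup>2 - 1)" unfolding area h by simp
    finally show ?thesis using h0 by simp
  qed
  ultimately have "admissible u v" using u v by (simp add: admissible_def)
  moreover have "perp_defect (dist B C) (dist C A) (dist A B) u v = 0"
    using c u v perp_defect_eq_inner[of u v B C A] by (simp add: crossing_def)
  moreover have "{closed_segment X P, closed_segment Y Q} = cutting_pair A B C u v"
    unfolding cutting_pair_def u(3,4) v(3,4) ..
  ultimately show ?thesis using that by blast
qed

text \<open>
  The far endpoints of the segments lie on the other two sides, and not both on the same one. If they
  lie there the other way round than in \<open>cutting_pair\<close>, the two segments are exchanged.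
\<close>

lemma quadrisection_imp_admissible:
  fixes A B C :: "real^2"
  assumes nc: "\<not> collinear {A, B, C}"
    and q: "quadrisection (convex hull {A, B, C}) q" "triangular_portion_on (convex hull {A, B, C}) q (closed_segment B C)"
  obtains u v where "admissible u v" "perp_defect (dist B C) (dist C A) (dist A B) u v = 0" "q = cutting_pair A B C u v"
proof -
  let ?T = "convex hull {A, B, C}"
  have "compact ?T" by (simp add: compact_convex_hull)
  then obtain X P Y Q Z where *: "q = {closed_segment X P, closed_segment Y Q}"
    "X \<in> closed_segment B C" "Y \<in> closed_segment B C" "quartered ?T X P Y Q Z"
    using quadrisection_imp_quartered[OF convex_convex_hull _ q] by blast
  have c: "crossing ?T X P Y Q Z" using *(4) by (simp add: quartered_def)
  have fr: "closed_segment B C \<subseteq> frontier ?T" by (auto simp: frontier_triangle)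
  have "P \<notin> closed_segment B C" "Q \<notin> closed_segment B C"
    using chord_not_within_side[OF c *(2) _ _ fr] chord_not_within_side[OF crossing_swap[OF c] *(3) _ _ fr] by auto
  moreover have "P \<in> frontier ?T" "Q \<in> frontier ?T" using c by (auto simp: crossing_def)
  ultimately have PQ: "P \<in> closed_segment A B \<or> P \<in> closed_segment C A" "Q \<in> closed_segment A B \<or> Q \<in> closed_segment C A"
    by (auto simp: frontier_triangle)
  have perm: "{A, C, B} = {A, B, C}" by auto
  have "False" if "P \<in> closed_segment A B" "Q \<in> closed_segment A B"
    using no_quartering_towards_one_side[of A C B X P Y Q Z] nc * that unfolding perm
    by (simp add: closed_segment_commute)
  moreover have "False" if "P \<in> closed_segment C A" "Q \<in> closed_segment C A"
    using no_quartering_towards_one_side[OF nc *(4,2,3) that] .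
  ultimately consider "P \<in> closed_segment C A" "Q \<in> closed_segment A B" | "Q \<in> closed_segment C A" "P \<in> closed_segment A B"
    using PQ by blast
  then show ?thesis
  proof cases
    case 1
    then show ?thesis using quartered_imp_admissible[OF nc *(4,2,3) 1] that *(1) by metis
  next
    case 2
    have "q = {closed_segment Y Q, closed_segment X P}" using *(1) by auto
    then show ?thesis using quartered_imp_admissible[OF nc quartered_swap[OF *(4)] *(3,2) 2] that by metis
  qed
qed

text \<open>
  The intersection point is written down explicitly, with the height \<open>h\<close> that makes the area of the
  triangular portion a quarter. The equation of \<open>admissible\<close> puts that point on both segments, and
  also gives \<open>u + v - 1 \<ge> 2/3\<close>, which keeps it strictly between their endpoints.
\<close>

lemma admissible_imp_quadrisection:
  fixes A B C :: "real^2"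
  assumes nc: "\<not> collinear {A, B, C}"
    and ad: "admissible u v" and perp: "perp_defect (dist B C) (dist C A) (dist A B) u v = 0"
  shows "quadrisection (convex hull {A, B, C}) (cutting_pair A B C u v)"
    and "triangular_portion_on (convex hull {A, B, C}) (cutting_pair A B C u v) (closed_segment B C)"
proof -
  let ?T = "convex hull {A, B, C}"
  have uv: "1/2 \<le> u" "u \<le> 1" "1/2 \<le> v" "v \<le> 1" "1 < u + v" "4 * (u + v - 1)\<^sup>2 = 2 * u\<^sup>2 + 2 * v\<^sup>2 - 1"
    using ad by (auto simp: admissible_def)
  define h where "h = 1 / (4 * (u + v - 1))"
  have wide: "2/3 \<le> u + v - 1"
  proof -
    have "(u + v)\<^sup>2 \<le> 2 * u\<^sup>2 + 2 * v\<^sup>2" using sum_squares_ge_zero[of "u - v" 0] by (simp add: power2_eq_square algebra_simps)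
    then have "0 \<le> (u + v - 1) * (3 * (u + v - 1) - 2)" using uv(6) by (simp add: power2_eq_square algebra_simps)
    then show ?thesis using uv(5) by (simp add: zero_le_mult_iff)
  qed
  have h: "0 < h" "2 * u * h < 1" "2 * v * h < 1" using uv wide by (simp_all add: h_def field_simps)
  have hw: "h * (u + v - 1) = 1/4" using uv by (simp add: h_def)
  have hh: "h * (2 * u\<^sup>2 + 2 * v\<^sup>2 - 1) = u + v - 1"
  proof -
    have "h * (4 * (u + v - 1)\<^sup>2) = 4 * (h * (u + v - 1)) * (u + v - 1)" by (simp add: power2_eq_square)
    then show ?thesis unfolding hw uv(6) by simp
  qed
  define X P Y Q where "X = C + u *\<^sub>R (B - C)" and "P = C + (1 / (2 * u)) *\<^sub>R (A - C)"
    and "Y = B + v *\<^sub>R (C - B)" and "Q = B + (1 / (2 * v)) *\<^sub>R (A - B)"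
  define Z where "Z = X + (2 * u * h) *\<^sub>R (P - X)"
  define e f where "e = B - C" and "f = A - C"
  have B: "B = C + e" "C - B = - e" "A - B = f - e" by (simp_all add: e_def f_def)
  have Xe: "X = C + u *\<^sub>R e" and Pe: "P = C + (1 / (2 * u)) *\<^sub>R f" by (simp_all add: X_def P_def e_def f_def)
  have Ye: "Y = C + (1 - v) *\<^sub>R e" unfolding Y_def B by (simp add: B(1) algebra_simps)
  have Qe: "Q = C + (1 - 1 / (2 * v)) *\<^sub>R e + (1 / (2 * v)) *\<^sub>R f" unfolding Q_def B(3) by (simp add: B(1) algebra_simps)
  have Ze: "Z = C + (u - 2 * u\<^sup>2 * h) *\<^sub>R e + h *\<^sub>R f"
    unfolding Z_def Xe Pe using uv by (simp add: algebra_simps power2_eq_square)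
  have x: "u - 2 * u\<^sup>2 * h = 1 - v + 2 * v\<^sup>2 * h - h" using hh by (simp add: algebra_simps)
  have ZY: "Z = Y + (2 * v * h) *\<^sub>R (Q - Y)"
    unfolding Ze x Ye Qe using uv by (simp add: algebra_simps power2_eq_square)
  have "X \<in> closed_segment C B" "P \<in> closed_segment C A" "Y \<in> closed_segment B C" "Q \<in> closed_segment B A"
    unfolding X_def P_def Y_def Q_def using uv by (auto intro!: point_in_closed_segment)
  then have seg: "X \<in> closed_segment B C" "P \<in> closed_segment C A" "Y \<in> closed_segment B C" "Q \<in> closed_segment A B"
    by (simp_all add: closed_segment_commute)
  have orth: "(P - X) \<bullet> (Q - Y) = 0"
    using perp perp_defect_eq_inner[of u v B C A] uv by (simp add: P_def X_def Q_def Y_def)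
  have int: "Z \<in> interior ?T"
  proof -
    have "Z = h *\<^sub>R A + (u - 2 * u\<^sup>2 * h) *\<^sub>R B + (1 - h - (u - 2 * u\<^sup>2 * h)) *\<^sub>R C"
      unfolding Ze e_def f_def by (simp add: algebra_simps)
    moreover have "u - 2 * u\<^sup>2 * h > 0"
    proof -
      have "u * (1 - 2 * u * h) > 0" using uv h by (intro mult_pos_pos) auto
      then show ?thesis by (simp add: algebra_simps power2_eq_square)
    qed
    moreover have "1 - h - (u - 2 * u\<^sup>2 * h) > 0"
    proof -
      have "v * (1 - 2 * v * h) > 0" using uv h by (intro mult_pos_pos) auto
      then show ?thesis unfolding x by (simp add: algebra_simps power2_eq_square)
    qed
    moreover have "x *\<^sub>R A + y *\<^sub>R B + z *\<^sub>R C \<in> interior ?T" if "0 < x" "0 < y" "0 < z" "x + y + z = 1" for x y z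
    proof -
      have "DIM(real^2) = 2" by simp
      from interior_convex_hull_3_minimal[OF nc this] show ?thesis using that by blast
    qed
    ultimately show ?thesis using h(1) by simp
  qed
  have c: "crossing ?T X P Y Q Z"
    unfolding crossing_def frontier_triangle
  proof (intro conjI)
    show "Z \<in> closed_segment X P" unfolding Z_def using h uv by (intro point_in_closed_segment) auto
    show "Z \<in> closed_segment Y Q" unfolding ZY using h uv by (intro point_in_closed_segment) auto
  qed (use seg orth int in auto)
  note on = crossing_on_lines[OF c] and on' = crossing_on_lines[OF crossing_swap[OF c]]
  have nz: "P - X \<noteq> 0" "Q - Y \<noteq> 0" using crossing_nonzero[OF c] crossing_nonzero[OF crossing_swap[OF c]] .
  obtain t where t: "t \<in> {1, -1}" "?T \<inter> {x. 0 \<le> (x - Z) \<bullet> (t *\<^sub>R (Q - Y))} = convex hull {C, X, P}"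
     "measure lebesgue (?T \<inter> {x. 0 \<le> (x - Z) \<bullet> (t *\<^sub>R (Q - Y))}) = u * (1 / (2 * u)) * measure lebesgue ?T"
    by (rule measure_corner_cut[OF nc X_def _ _ P_def _ _ on nz(2)]) (use uv in auto)
  have perm: "{A, C, B} = {A, B, C}" by auto
  obtain s where s: "s \<in> {1, -1}"
     "measure lebesgue (?T \<inter> {x. 0 \<le> (x - Z) \<bullet> (s *\<^sub>R (P - X))}) = v * (1 / (2 * v)) * measure lebesgue ?T"
    by (rule measure_corner_cut[of A C B, unfolded perm, OF nc Y_def _ _ Q_def _ _ on' nz(1)]) (use uv in auto)
  \<comment> \<open>Cutting first along the segment from \<open>X\<close> leaves the triangle \<open>CXP\<close>; the other segment cuts off its corner \<open>X\<close>.\<close>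
  have quad: "quadrant ?T Z ((-1) *\<^sub>R (P - X)) (t *\<^sub>R (Q - Y)) = convex hull {X, Z, Y}"
  proof -
    have "C - X = (- u) *\<^sub>R e" by (simp add: Xe)
    then have "((u + v - 1) / u) *\<^sub>R (C - X) = - ((u + v - 1) *\<^sub>R e)" using uv by simp
    then have r: "Y = X + ((u + v - 1) / u) *\<^sub>R (C - X)" unfolding Xe Ye by (simp add: algebra_simps)
    have "0 < (X - Z) \<bullet> (X - P)"
    proof -
      have "X - Z = (2 * u * h) *\<^sub>R (X - P)" unfolding Z_def by (simp add: algebra_simps)
      moreover have "0 < 2 * u * h" using uv h by simp
      ultimately show ?thesis using nz by simp
    qed
    moreover have "(Y - Z) \<bullet> (X - P) = 0" using on' by (simp add: inner_diff_right)
    moreover have "0 < (u + v - 1) / u" "(u + v - 1) / u \<le> 1" "0 < 2 * u * h" using uv h by simp_all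
    ultimately have "convex hull {P, C, X} \<inter> {x. 0 \<le> (x - Z) \<bullet> (X - P)} = convex hull {X, Y, Z}"
      using h by (intro corner_cut[OF r _ _ Z_def]) auto
    moreover have "{P, C, X} = {C, X, P}" "{X, Y, Z} = {X, Z, Y}" by auto
    moreover have "quadrant ?T Z ((-1) *\<^sub>R (P - X)) (t *\<^sub>R (Q - Y)) =
       (?T \<inter> {x. 0 \<le> (x - Z) \<bullet> (t *\<^sub>R (Q - Y))}) \<inter> {x. 0 \<le> (x - Z) \<bullet> (X - P)}"
      by (auto simp: quadrant_def)
    ultimately show ?thesis using t(2) by simp
  qed
  have "measure lebesgue (convex hull {X, Z, Y}) = \<bar>- (h * ((1 - v) - u))\<bar> * measure lebesgue ?T"
    using measure_triangle_in_coordinates[of C u B 0 A "u - 2 * u\<^sup>2 * h" h "1 - v" 0] Xe Ye Ze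
    by (simp add: e_def f_def)
  also have "- (h * ((1 - v) - u)) = 1/4" using hw by (simp add: algebra_simps)
  finally have area: "measure lebesgue (convex hull {X, Z, Y}) = measure lebesgue ?T / 4" by simp
  have half: "u * (1 / (2 * u)) * measure lebesgue ?T = measure lebesgue ?T / 2"
     "v * (1 / (2 * v)) * measure lebesgue ?T = measure lebesgue ?T / 2" using uv by simp_all
  have eq: "cutting_pair A B C u v = {closed_segment X P, closed_segment Y Q}"
    by (simp add: cutting_pair_def X_def P_def Y_def Q_def)
  have "compact ?T" by (simp add: compact_convex_hull)
  note quadrisection_of_crossing[OF convex_convex_hull this c seg(1,3) s(2)[unfolded half] t(3)[unfolded half] s(1) t(1) quad _ t(1) area]
  then show "quadrisection ?T (cutting_pair A B C u v)"
    "triangular_portion_on ?T (cutting_pair A B C u v) (closed_segment B C)" unfolding eq by simp_all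
qed

section \<open>Sides by length\<close>

lemma triangle_side_vertices:
  assumes "triangle T" "s edge_of T"
  obtains A B C where "\<not> collinear {A, B, C}" "T = convex hull {A, B, C}" "s = closed_segment B C"
proof -
  obtain A B C where T: "\<not> collinear {A, B, C}" "T = convex hull {A, B, C}" using assms(1) by (auto simp: triangle_def)
  have perm: "{B, C, A} = {A, B, C}" "{C, A, B} = {A, B, C}" by auto
  have "s \<in> {closed_segment A B, closed_segment B C, closed_segment C A}"
    using assms(2) edge_of_triangle[OF T(1)] T(2) by simp
  then show ?thesis using that[of A B C] that[of B C A] that[of C A B] T unfolding perm by auto
qed

text \<open>
  Exchanging the names of \<open>B\<close> and \<open>C\<close> exchanges the other two sides, so the shorter one may be taken
  to be \<open>AB\<close>.
\<close>

lemma middle_leg_vertices: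
  assumes "triangle T" "middle_leg T m"
  obtains A B C where "\<not> collinear {A, B, C}" "T = convex hull {A, B, C}" "m = closed_segment B C"
    "dist A B < dist B C" "dist B C < dist C A"
proof -
  have m: "m edge_of T" using assms(2) by (simp add: middle_leg_def)
  obtain A B C where T: "\<not> collinear {A, B, C}" "T = convex hull {A, B, C}" "m = closed_segment B C"
    using triangle_side_vertices[OF assms(1) m] .
  have ed: "s edge_of T \<longleftrightarrow> s \<in> {closed_segment A B, closed_segment B C, closed_segment C A}" for s
    using edge_of_triangle[OF T(1)] T(2) by simp
  have "(dist A B < dist B C \<or> dist C A < dist B C) \<and> (dist B C < dist A B \<or> dist B C < dist C A)"
    using assms(2) unfolding middle_leg_def ed T(3) by (auto simp: diameter_closed_segment_eq)
  then consider "dist A B < dist B C" "dist B C < dist C A" | "dist A C < dist C B" "dist C B < dist B A"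
    by (auto simp: dist_commute)
  then show ?thesis
  proof cases
    case 1 then show ?thesis using that[of A B C] T by simp
  next
    case 2
    have "{A, C, B} = {A, B, C}" by auto
    then show ?thesis using that[of A C B] T 2 by (simp add: closed_segment_commute)
  qed
qed

lemma longest_leg_vertices:
  assumes "triangle T" "longest_leg T l"
  obtains A B C where "\<not> collinear {A, B, C}" "T = convex hull {A, B, C}" "l = closed_segment B C"
    "dist A B < dist B C" "dist C A < dist B C"
proof -
  have m: "l edge_of T" using assms(2) by (simp add: longest_leg_def)
  obtain A B C where T: "\<not> collinear {A, B, C}" "T = convex hull {A, B, C}" "l = closed_segment B C"
    using triangle_side_vertices[OF assms(1) m] .
  have ne: "A \<noteq> B" "B \<noteq> C" "C \<noteq> A" using T(1) by (metis collinear_2 insert_absorb2 insert_commute)+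
  have "closed_segment A B \<noteq> l" "closed_segment C A \<noteq> l" using ne unfolding T(3) by (auto simp: doubleton_eq_iff)
  moreover have "closed_segment A B edge_of T" "closed_segment C A edge_of T"
    using edge_of_triangle[OF T(1)] T(2) by simp_all
  ultimately have "diameter (closed_segment A B) < diameter l" "diameter (closed_segment C A) < diameter l"
    using assms(2) by (simp_all add: longest_leg_def)
  then show ?thesis using that[OF T] by (simp add: diameter_closed_segment_eq T(3))
qed

theorem theorem2:
  fixes T m l :: "(real^2) set"
  assumes "scalene_triangle T"
    and "middle_leg T m"
    and "longest_leg T l"
  shows "(\<exists>!q. quadrisection T q \<and> triangular_portion_on T q m) \<and>
         \<not> (\<exists>q. quadrisection T q \<and> triangular_portion_on T q l)"
proof
  have T: "triangle T" using assms(1) by (simp add: scalene_triangle_def)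
  show "\<exists>!q. quadrisection T q \<and> triangular_portion_on T q m"
  proof -
    obtain A B C where ABC: "\<not> collinear {A, B, C}" "T = convex hull {A, B, C}" "m = closed_segment B C"
      "dist A B < dist B C" "dist B C < dist C A"
      using middle_leg_vertices[OF T assms(2)] .
    have "0 < dist A B" using ABC(1) by auto
    from unique_admissible_perp[OF this ABC(4,5)] obtain u v where uv: "admissible u v" "perp_defect (dist B C) (dist C A) (dist A B) u v = 0"
      "\<And>u' v'. admissible u' v' \<Longrightarrow> perp_defect (dist B C) (dist C A) (dist A B) u' v' = 0 \<Longrightarrow> u' = u \<and> v' = v"
      by blast
    show ?thesis
    proof (rule ex1I[of _ "cutting_pair A B C u v"])
      show "quadrisection T (cutting_pair A B C u v) \<and> triangular_portion_on T (cutting_pair A B C u v) m"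
        using admissible_imp_quadrisection[OF ABC(1) uv(1,2)] ABC by simp
      fix q assume "quadrisection T q \<and> triangular_portion_on T q m"
      then obtain u' v' where "admissible u' v'" "perp_defect (dist B C) (dist C A) (dist A B) u' v' = 0"
        "q = cutting_pair A B C u' v'"
        using quadrisection_imp_admissible[OF ABC(1)] ABC by blast
      then show "q = cutting_pair A B C u v" using uv(3) by blast
    qed
  qed
  show "\<not> (\<exists>q. quadrisection T q \<and> triangular_portion_on T q l)"
  proof
    assume "\<exists>q. quadrisection T q \<and> triangular_portion_on T q l"
    then obtain q where q: "quadrisection T q" "triangular_portion_on T q l" by blast
    obtain A B C where ABC: "\<not> collinear {A, B, C}" "T = convex hull {A, B, C}" "l = closed_segment B C"
      "dist A B < dist B C" "dist C A < dist B C"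
      using longest_leg_vertices[OF T assms(3)] .
    obtain u v where "admissible u v" "perp_defect (dist B C) (dist C A) (dist A B) u v = 0"
      using quadrisection_imp_admissible[OF ABC(1)] q ABC by blast
    moreover have "0 < dist C A" "0 < dist A B" using ABC(1) by (auto simp: insert_commute)
    ultimately show False using no_admissible_perp[of "dist C A" "dist B C" "dist A B"] ABC by blast
  qed
qed

end
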